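(* Let $R$ be a 2-primal Zhou nil-clean ring. Then for every $n\in\mathbb{N}$, $n\ge 1$, every matrix $A\in M_n(R)$ is the sum of two tripotents and a nilpotent; that is, there exist $E,F,W\in M_n(R)$ with $E^3=E$, $F^3=F$, $W$ nilpotent and $A=E+F+W$.
   Context: All rings are associative with identity (not necessarily commutative). $M_n(R)$ is the ring of $n\times n$ matrices over $R$. An element $a$ of a ring is tripotent if $a=a^3$. A ring $R$ is Zhou nil-clean if every element of $R$ is the sum of two tripotents and a nilpotent that commute with one another (i.e. every $a\in R$ can be written $a=e+f+w$ with $e^3=e$, $f^3=f$, $w$ nilpotent, and $e,f,w$ pairwise commuting). A ring $R$ is 2-primal if its Baer-McCoy radical, i.e. the intersection of all prime ideals of $R$, coincides with the set of nilpotent elements of $R$. No commutation among the matrices $E,F,W$ in the conclusion is asserted. *)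

theory Defs
  imports "HOL-Algebra.Ideal_Product" "Jordan_Normal_Form.Matrix"
begin

text \<open>
  Rings are those of the locale \<^locale>\<open>ring\<close>: associative, with identity, not necessarily
  commutative (and possibly zero).
\<close>

definition tripotent :: "('a, 'b) ring_scheme \<Rightarrow> 'a \<Rightarrow> bool" where
  "tripotent R a \<longleftrightarrow> a \<in> carrier R \<and> a [^]\<^bsub>R\<^esub> (3::nat) = a"

definition nilpotent :: "('a, 'b) ring_scheme \<Rightarrow> 'a \<Rightarrow> bool" where
  "nilpotent R a \<longleftrightarrow> a \<in> carrier R \<and> (\<exists>k::nat. a [^]\<^bsub>R\<^esub> k = \<zero>\<^bsub>R\<^esub>)"

definition commuting :: "('a, 'b) ring_scheme \<Rightarrow> 'a \<Rightarrow> 'a \<Rightarrow> bool" where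
  "commuting R a b \<longleftrightarrow> a \<otimes>\<^bsub>R\<^esub> b = b \<otimes>\<^bsub>R\<^esub> a"

definition zhou_nil_clean :: "('a, 'b) ring_scheme \<Rightarrow> bool" where
  "zhou_nil_clean R \<longleftrightarrow>
    (\<forall>a\<in>carrier R. \<exists>e f w.
       tripotent R e \<and> tripotent R f \<and> nilpotent R w \<and>
       commuting R e f \<and> commuting R e w \<and> commuting R f w \<and>
       a = e \<oplus>\<^bsub>R\<^esub> f \<oplus>\<^bsub>R\<^esub> w)"

text \<open>
  The library's \<^locale>\<open>primeideal\<close> is the elementwise notion and is restricted to commutative
  rings. Over a noncommutative ring primeness is expressed through products of two-sided ideals.
\<close>

definition nc_prime_ideal :: "('a, 'b) ring_scheme \<Rightarrow> 'a set \<Rightarrow> bool" where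
  "nc_prime_ideal R P \<longleftrightarrow>
    ideal P R \<and> P \<noteq> carrier R \<and>
    (\<forall>I J. ideal I R \<longrightarrow> ideal J R \<longrightarrow> ideal_prod R I J \<subseteq> P \<longrightarrow> I \<subseteq> P \<or> J \<subseteq> P)"

text \<open>The intersection is taken inside the carrier, so it is the carrier for the zero ring.\<close>

definition baer_mccoy_radical :: "('a, 'b) ring_scheme \<Rightarrow> 'a set" where
  "baer_mccoy_radical R = carrier R \<inter> \<Inter> {P. nc_prime_ideal R P}"

definition two_primal :: "('a, 'b) ring_scheme \<Rightarrow> bool" where
  "two_primal R \<longleftrightarrow> baer_mccoy_radical R = {a. nilpotent R a}"

text \<open>
  The library's \<^const>\<open>ring_mat\<close> takes its entries from a type of class \<^class>\<open>semiring_1\<close>, not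
  from a ring with an explicit carrier. Only its underlying type of matrices is used here.
\<close>

definition mat_ring :: "('a, 'b) ring_scheme \<Rightarrow> nat \<Rightarrow> 'a mat ring" where
  "mat_ring R n =
    \<lparr>carrier = {A \<in> carrier_mat n n. elements_mat A \<subseteq> carrier R},
     monoid.mult = (\<lambda>A B. mat n n (\<lambda>(i, j). \<Oplus>\<^bsub>R\<^esub>k\<in>{..<n}. A $$ (i, k) \<otimes>\<^bsub>R\<^esub> B $$ (k, j))),
     one = mat n n (\<lambda>(i, j). if i = j then \<one>\<^bsub>R\<^esub> else \<zero>\<^bsub>R\<^esub>),
     zero = mat n n (\<lambda>_. \<zero>\<^bsub>R\<^esub>),
     add = (\<lambda>A B. mat n n (\<lambda>(i, j). A $$ (i, j) \<oplus>\<^bsub>R\<^esub> B $$ (i, j)))\<rparr>"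

end

theory Submission
  imports
    Defs
    "HOL-Algebra.Ring_Divisibility"
    "HOL-Algebra.Chinese_Remainder"
    "Jordan_Normal_Form.Determinant"
    "Berlekamp_Zassenhaus.Finite_Field"
begin

text \<open>
  Let \<open>P\<close> be the prime radical of \<open>R\<close>. Since \<open>R\<close> is 2-primal, \<open>P\<close> is the set of nilpotent
  elements, so \<open>R / P\<close> is reduced and each of its elements is a sum \<open>s\<close> of two commuting tripotents.
  Such a sum takes only the values \<open>-2, ..., 2\<close>, that is, it satisfies
  \<open>s^5 - 5 s^3 + 4 s = 0\<close>. For \<open>s = 3\<close> this gives \<open>120 = 0\<close>, hence \<open>30 = 0\<close> in the reduced ring
  \<open>R / P\<close>; then the relation becomes \<open>s^5 = s\<close>
  (\<open>sum_of_commuting_tripotents_quintic\<close>), and a ring with \<open>x^5 = x\<close> is commutative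
  (\<open>quintic_commutative\<close>). So the problem splits into two: decompose the matrices over the
  commutative ring \<open>S = R / P\<close>, and lift the decomposition along \<open>M_n(R) \<rightarrow> M_n(S)\<close>.

  \<^bold>\<open>Decomposing over \<open>S\<close>.\<close> A ring with \<open>x^5 = x\<close> is locally a prime field with 2, 3 or 5 elements:
  finitely many elements can be made integer multiples of the unit, of characteristic 2, 3 or 5, by
  cutting with orthogonal idempotents (\<open>separate_characteristic\<close>, \<open>separate_finite\<close>). Hence it is
  enough to treat matrices over these fields. Over a field every matrix is similar to a block
  triangular matrix with companion matrices on the diagonal, and for the existence of a decomposition
  the blocks above the diagonal can be put into the nilpotent summand
  (\<open>four_block_triangular_tripotent_nil_sum\<close>). A companion matrix is its nilpotent subdiagonal plus
  its last column. A matrix supported on the last column whose corner entry is \<open>1\<close> or \<open>-1\<close> is, up to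
  sign, an idempotent; and in the three fields each element is \<open>1\<close> or \<open>-1\<close> or a sum of two of
  these, so the last column is a sum of at most two such matrices
  (\<open>companion_tripotent_nil_sum\<close>).

  \<^bold>\<open>Lifting to \<open>R\<close>.\<close> A matrix over the prime radical is nilpotent
  (\<open>mat_over_prime_radical_nilpotent\<close>), so the kernel of \<open>M_n(R) \<rightarrow> M_n(S)\<close> is nil. Tripotents need
  not lift modulo a nil ideal when 2 is not invertible, but differences of two orthogonal idempotents
  do. Therefore all tripotents are constructed in this form, called split below
  (\<open>lift_tripotent_nil_sum\<close>).
\<close>

section \<open>Matrices over a ring\<close>

lemma mat_ring_carrier_iff:
  "A \<in> carrier (mat_ring R n) \<longleftrightarrow>
     A \<in> carrier_mat n n \<and> (\<forall>i<n. \<forall>j<n. A $$ (i, j) \<in> carrier R)"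
  unfolding mat_ring_def by (fastforce simp: elements_mat_def)

lemma mat_ring_index:
  assumes "i < n" "j < n"
  shows mat_ring_index_mult:
      "(A \<otimes>\<^bsub>mat_ring R n\<^esub> B) $$ (i, j) = (\<Oplus>\<^bsub>R\<^esub>k\<in>{..<n}. A $$ (i, k) \<otimes>\<^bsub>R\<^esub> B $$ (k, j))"
    and mat_ring_index_add: "(A \<oplus>\<^bsub>mat_ring R n\<^esub> B) $$ (i, j) = A $$ (i, j) \<oplus>\<^bsub>R\<^esub> B $$ (i, j)"
    and mat_ring_index_zero: "\<zero>\<^bsub>mat_ring R n\<^esub> $$ (i, j) = \<zero>\<^bsub>R\<^esub>"
    and mat_ring_index_one: "\<one>\<^bsub>mat_ring R n\<^esub> $$ (i, j) = (if i = j then \<one>\<^bsub>R\<^esub> else \<zero>\<^bsub>R\<^esub>)"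
  using assms by (simp_all add: mat_ring_def)

lemma mat_ring_dim:
  "A \<otimes>\<^bsub>mat_ring R n\<^esub> B \<in> carrier_mat n n"
  "A \<oplus>\<^bsub>mat_ring R n\<^esub> B \<in> carrier_mat n n"
  "\<zero>\<^bsub>mat_ring R n\<^esub> \<in> carrier_mat n n"
  "\<one>\<^bsub>mat_ring R n\<^esub> \<in> carrier_mat n n"
  by (simp_all add: mat_ring_def)

lemma mat_ring_eqI:
  assumes "A \<in> carrier_mat n n" "B \<in> carrier_mat n n"
    and "\<And>i j. i < n \<Longrightarrow> j < n \<Longrightarrow> A $$ (i, j) = B $$ (i, j)"
  shows "A = B"
  using assms by (intro eq_matI) auto

lemma (in abelian_monoid) finsum_swap:
  assumes "finite A" "finite B" "\<And>i j. i \<in> A \<Longrightarrow> j \<in> B \<Longrightarrow> f i j \<in> carrier G"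
  shows "(\<Oplus>i\<in>A. \<Oplus>j\<in>B. f i j) = (\<Oplus>j\<in>B. \<Oplus>i\<in>A. f i j)"
  using assms(1,3)
proof (induction A rule: finite_induct)
  case empty
  then show ?case by simp
next
  case (insert a A)
  have "(\<Oplus>i\<in>insert a A. \<Oplus>j\<in>B. f i j) = (\<Oplus>j\<in>B. f a j) \<oplus> (\<Oplus>j\<in>B. \<Oplus>i\<in>A. f i j)"
    using insert by (subst finsum_insert) (auto intro!: finsum_closed)
  also have "\<dots> = (\<Oplus>j\<in>B. f a j \<oplus> (\<Oplus>i\<in>A. f i j))"
    using insert by (subst finsum_addf) (auto intro!: finsum_closed)
  also have "\<dots> = (\<Oplus>j\<in>B. \<Oplus>i\<in>insert a A. f i j)"
    using insert by (intro finsum_cong' refl) (auto intro!: finsum_closed)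
  finally show ?case .
qed

lemma (in ring) mat_ring_assoc:
  assumes "A \<in> carrier (mat_ring R n)" "B \<in> carrier (mat_ring R n)" "C \<in> carrier (mat_ring R n)"
  shows "A \<otimes>\<^bsub>mat_ring R n\<^esub> B \<otimes>\<^bsub>mat_ring R n\<^esub> C = A \<otimes>\<^bsub>mat_ring R n\<^esub> (B \<otimes>\<^bsub>mat_ring R n\<^esub> C)"
proof (rule mat_ring_eqI[OF mat_ring_dim(1) mat_ring_dim(1)])
  fix i j assume ij: "i < n" "j < n"
  have c: "A $$ (k, l) \<in> carrier R" "B $$ (k, l) \<in> carrier R" "C $$ (k, l) \<in> carrier R"
    if "k < n" "l < n" for k l
    using assms that unfolding mat_ring_carrier_iff by auto
  have "(A \<otimes>\<^bsub>mat_ring R n\<^esub> B \<otimes>\<^bsub>mat_ring R n\<^esub> C) $$ (i, j)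
      = (\<Oplus>k\<in>{..<n}. (\<Oplus>l\<in>{..<n}. A $$ (i, l) \<otimes> B $$ (l, k)) \<otimes> C $$ (k, j))"
    unfolding mat_ring_index[OF ij] using ij c
    by (intro finsum_cong') (auto simp: mat_ring_index intro!: finsum_closed)
  also have "\<dots> = (\<Oplus>k\<in>{..<n}. \<Oplus>l\<in>{..<n}. A $$ (i, l) \<otimes> (B $$ (l, k) \<otimes> C $$ (k, j)))"
    using ij c by (intro finsum_cong') (auto simp: finsum_ldistr m_assoc intro!: finsum_closed finsum_cong')
  also have "\<dots> = (\<Oplus>l\<in>{..<n}. \<Oplus>k\<in>{..<n}. A $$ (i, l) \<otimes> (B $$ (l, k) \<otimes> C $$ (k, j)))"
    using ij c by (intro finsum_swap) auto
  also have "\<dots> = (\<Oplus>l\<in>{..<n}. A $$ (i, l) \<otimes> (\<Oplus>k\<in>{..<n}. B $$ (l, k) \<otimes> C $$ (k, j)))"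
    using ij c by (intro finsum_cong') (auto simp: finsum_rdistr intro!: finsum_closed)
  also have "\<dots> = (A \<otimes>\<^bsub>mat_ring R n\<^esub> (B \<otimes>\<^bsub>mat_ring R n\<^esub> C)) $$ (i, j)"
    unfolding mat_ring_index[OF ij] using ij c
    by (intro finsum_cong') (auto simp: mat_ring_index intro!: finsum_closed)
  finally show "(A \<otimes>\<^bsub>mat_ring R n\<^esub> B \<otimes>\<^bsub>mat_ring R n\<^esub> C) $$ (i, j) =
    (A \<otimes>\<^bsub>mat_ring R n\<^esub> (B \<otimes>\<^bsub>mat_ring R n\<^esub> C)) $$ (i, j)" .
qed

lemma (in ring) mat_ring_one_mult:
  assumes "A \<in> carrier (mat_ring R n)"
  shows "\<one>\<^bsub>mat_ring R n\<^esub> \<otimes>\<^bsub>mat_ring R n\<^esub> A = A" "A \<otimes>\<^bsub>mat_ring R n\<^esub> \<one>\<^bsub>mat_ring R n\<^esub> = A"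
proof -
  have A: "A \<in> carrier_mat n n" and c: "\<And>k l. k < n \<Longrightarrow> l < n \<Longrightarrow> A $$ (k, l) \<in> carrier R"
    using assms unfolding mat_ring_carrier_iff by auto
  have "(\<one>\<^bsub>mat_ring R n\<^esub> \<otimes>\<^bsub>mat_ring R n\<^esub> A) $$ (i, j) = A $$ (i, j)" if ij: "i < n" "j < n" for i j
  proof -
    have "(\<one>\<^bsub>mat_ring R n\<^esub> \<otimes>\<^bsub>mat_ring R n\<^esub> A) $$ (i, j)
        = (\<Oplus>k\<in>{..<n}. if i = k then A $$ (k, j) else \<zero>)"
      unfolding mat_ring_index[OF ij] using ij c
      by (intro finsum_cong') (auto simp: mat_ring_index)
    also have "\<dots> = A $$ (i, j)"
      using ij c by (intro finsum_singleton) auto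
    finally show ?thesis .
  qed
  then show "\<one>\<^bsub>mat_ring R n\<^esub> \<otimes>\<^bsub>mat_ring R n\<^esub> A = A"
    by (intro mat_ring_eqI[OF mat_ring_dim(1) A])
  have "(A \<otimes>\<^bsub>mat_ring R n\<^esub> \<one>\<^bsub>mat_ring R n\<^esub>) $$ (i, j) = A $$ (i, j)" if ij: "i < n" "j < n" for i j
  proof -
    have "(A \<otimes>\<^bsub>mat_ring R n\<^esub> \<one>\<^bsub>mat_ring R n\<^esub>) $$ (i, j)
        = (\<Oplus>k\<in>{..<n}. if j = k then A $$ (i, k) else \<zero>)"
      unfolding mat_ring_index[OF ij] using ij c
      by (intro finsum_cong') (auto simp: mat_ring_index)
    also have "\<dots> = A $$ (i, j)"
      using ij c by (intro finsum_singleton) auto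
    finally show ?thesis .
  qed
  then show "A \<otimes>\<^bsub>mat_ring R n\<^esub> \<one>\<^bsub>mat_ring R n\<^esub> = A"
    by (intro mat_ring_eqI[OF mat_ring_dim(1) A])
qed

lemma (in ring) mat_ring_ring: "ring (mat_ring R n)"
proof (rule ringI)
  let ?M = "mat_ring R n"
  note iff = mat_ring_carrier_iff and dim = mat_ring_dim and idx = mat_ring_index
  have add_closed: "x \<oplus>\<^bsub>?M\<^esub> y \<in> carrier ?M" if "x \<in> carrier ?M" "y \<in> carrier ?M" for x y
    using that by (auto simp: iff dim idx)
  have mult_closed: "x \<otimes>\<^bsub>?M\<^esub> y \<in> carrier ?M" if "x \<in> carrier ?M" "y \<in> carrier ?M" for x y
    using that by (auto simp: iff dim idx intro!: finsum_closed)
  show "abelian_group ?M"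
  proof (rule abelian_groupI)
    fix x assume x: "x \<in> carrier ?M"
    show "\<exists>y\<in>carrier ?M. y \<oplus>\<^bsub>?M\<^esub> x = \<zero>\<^bsub>?M\<^esub>"
    proof (rule bexI)
      show "mat n n (\<lambda>(i, j). \<ominus> x $$ (i, j)) \<oplus>\<^bsub>?M\<^esub> x = \<zero>\<^bsub>?M\<^esub>"
        using x by (intro mat_ring_eqI[where n = n] dim) (auto simp: idx iff l_neg)
      show "mat n n (\<lambda>(i, j). \<ominus> x $$ (i, j)) \<in> carrier ?M"
        using x by (auto simp: iff)
    qed
  next
    fix x y z assume xyz: "x \<in> carrier ?M" "y \<in> carrier ?M" "z \<in> carrier ?M"
    show "x \<oplus>\<^bsub>?M\<^esub> y \<oplus>\<^bsub>?M\<^esub> z = x \<oplus>\<^bsub>?M\<^esub> (y \<oplus>\<^bsub>?M\<^esub> z)"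
      by (rule mat_ring_eqI[OF dim(2) dim(2)]) (use xyz in \<open>simp add: idx iff a_ac\<close>)
    show "x \<oplus>\<^bsub>?M\<^esub> y = y \<oplus>\<^bsub>?M\<^esub> x"
      by (rule mat_ring_eqI[OF dim(2) dim(2)]) (use xyz in \<open>simp add: idx iff a_ac\<close>)
    show "\<zero>\<^bsub>?M\<^esub> \<oplus>\<^bsub>?M\<^esub> x = x"
      by (rule mat_ring_eqI[OF dim(2)]) (use xyz in \<open>simp_all add: idx iff\<close>)
  qed (simp_all add: add_closed iff dim idx)
  show "monoid ?M"
    by (rule monoidI) (auto simp: mult_closed mat_ring_assoc mat_ring_one_mult iff dim idx)
  fix x y z assume xyz: "x \<in> carrier ?M" "y \<in> carrier ?M" "z \<in> carrier ?M"
  then have c: "x $$ (i, j) \<in> carrier R" "y $$ (i, j) \<in> carrier R" "z $$ (i, j) \<in> carrier R"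
    if "i < n" "j < n" for i j
    using that by (auto simp: iff)
  show "(x \<oplus>\<^bsub>?M\<^esub> y) \<otimes>\<^bsub>?M\<^esub> z = x \<otimes>\<^bsub>?M\<^esub> z \<oplus>\<^bsub>?M\<^esub> y \<otimes>\<^bsub>?M\<^esub> z"
  proof (rule mat_ring_eqI[OF dim(1) dim(2)])
    fix i j assume ij: "i < n" "j < n"
    have "((x \<oplus>\<^bsub>?M\<^esub> y) \<otimes>\<^bsub>?M\<^esub> z) $$ (i, j)
        = (\<Oplus>k\<in>{..<n}. x $$ (i, k) \<otimes> z $$ (k, j) \<oplus> y $$ (i, k) \<otimes> z $$ (k, j))"
      unfolding idx(1)[OF ij] using ij c by (intro finsum_cong') (auto simp: idx l_distr)
    also have "\<dots> = (\<Oplus>k\<in>{..<n}. x $$ (i, k) \<otimes> z $$ (k, j)) \<oplus> (\<Oplus>k\<in>{..<n}. y $$ (i, k) \<otimes> z $$ (k, j))"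
      using ij c by (intro finsum_addf) auto
    finally show "((x \<oplus>\<^bsub>?M\<^esub> y) \<otimes>\<^bsub>?M\<^esub> z) $$ (i, j) = (x \<otimes>\<^bsub>?M\<^esub> z \<oplus>\<^bsub>?M\<^esub> y \<otimes>\<^bsub>?M\<^esub> z) $$ (i, j)"
      unfolding idx[OF ij] .
  qed
  show "z \<otimes>\<^bsub>?M\<^esub> (x \<oplus>\<^bsub>?M\<^esub> y) = z \<otimes>\<^bsub>?M\<^esub> x \<oplus>\<^bsub>?M\<^esub> z \<otimes>\<^bsub>?M\<^esub> y"
  proof (rule mat_ring_eqI[OF dim(1) dim(2)])
    fix i j assume ij: "i < n" "j < n"
    have "(z \<otimes>\<^bsub>?M\<^esub> (x \<oplus>\<^bsub>?M\<^esub> y)) $$ (i, j)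
        = (\<Oplus>k\<in>{..<n}. z $$ (i, k) \<otimes> x $$ (k, j) \<oplus> z $$ (i, k) \<otimes> y $$ (k, j))"
      unfolding idx(1)[OF ij] using ij c by (intro finsum_cong') (auto simp: idx r_distr)
    also have "\<dots> = (\<Oplus>k\<in>{..<n}. z $$ (i, k) \<otimes> x $$ (k, j)) \<oplus> (\<Oplus>k\<in>{..<n}. z $$ (i, k) \<otimes> y $$ (k, j))"
      using ij c by (intro finsum_addf) auto
    finally show "(z \<otimes>\<^bsub>?M\<^esub> (x \<oplus>\<^bsub>?M\<^esub> y)) $$ (i, j) = (z \<otimes>\<^bsub>?M\<^esub> x \<oplus>\<^bsub>?M\<^esub> z \<otimes>\<^bsub>?M\<^esub> y) $$ (i, j)"
      unfolding idx[OF ij] .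
  qed
qed

lemma (in ring_hom_ring) hom_finsum_ring:
  assumes "finite A" "f \<in> A \<rightarrow> carrier R"
  shows "h (\<Oplus>\<^bsub>R\<^esub>i\<in>A. f i) = (\<Oplus>\<^bsub>S\<^esub>i\<in>A. h (f i))"
  using assms
proof (induction A rule: finite_induct)
  case (insert a A)
  then have "(\<lambda>i. h (f i)) \<in> A \<rightarrow> carrier S" "h (f a) \<in> carrier S" by (auto simp: Pi_iff)
  with insert show ?case by (auto simp: R.finsum_insert S.finsum_insert R.finsum_closed)
qed simp

lemma (in ring_hom_ring) mat_ring_hom:
  "ring_hom_ring (mat_ring R n) (mat_ring S n) (map_mat h)"
proof (rule ring_hom_ringI2[OF R.mat_ring_ring S.mat_ring_ring])
  let ?M = "mat_ring R n" and ?N = "mat_ring S n"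
  note iff = mat_ring_carrier_iff and dim = mat_ring_dim and idx = mat_ring_index
  show "map_mat h \<in> Ring.ring_hom ?M ?N"
  proof (rule ring_hom_memI)
    fix x assume "x \<in> carrier ?M"
    then show "map_mat h x \<in> carrier ?N" by (auto simp: iff)
  next
    fix x y assume xy: "x \<in> carrier ?M" "y \<in> carrier ?M"
    have d: "map_mat h X \<in> carrier_mat n n \<longleftrightarrow> X \<in> carrier_mat n n" for X by auto
    have m: "map_mat h X $$ (i, j) = h (X $$ (i, j))" if "X \<in> carrier_mat n n" "i < n" "j < n" for X i j
      using that by auto
    show "map_mat h (x \<otimes>\<^bsub>?M\<^esub> y) = map_mat h x \<otimes>\<^bsub>?N\<^esub> map_mat h y"
    proof (rule mat_ring_eqI[where n = n])
      fix i j assume ij: "i < n" "j < n"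
      have "map_mat h (x \<otimes>\<^bsub>?M\<^esub> y) $$ (i, j) = h (\<Oplus>\<^bsub>R\<^esub>k\<in>{..<n}. x $$ (i, k) \<otimes>\<^bsub>R\<^esub> y $$ (k, j))"
        using ij by (simp add: m[OF dim(1)] idx)
      also have "\<dots> = (\<Oplus>\<^bsub>S\<^esub>k\<in>{..<n}. h (x $$ (i, k) \<otimes>\<^bsub>R\<^esub> y $$ (k, j)))"
        using ij xy by (intro hom_finsum_ring) (auto simp: iff)
      also have "\<dots> = (\<Oplus>\<^bsub>S\<^esub>k\<in>{..<n}. map_mat h x $$ (i, k) \<otimes>\<^bsub>S\<^esub> map_mat h y $$ (k, j))"
        using ij xy by (intro S.finsum_cong') (auto simp: iff)
      finally show "map_mat h (x \<otimes>\<^bsub>?M\<^esub> y) $$ (i, j) = (map_mat h x \<otimes>\<^bsub>?N\<^esub> map_mat h y) $$ (i, j)"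
        using ij by (simp add: idx)
    qed (use xy in \<open>auto simp: dim d\<close>)
    show "map_mat h (x \<oplus>\<^bsub>?M\<^esub> y) = map_mat h x \<oplus>\<^bsub>?N\<^esub> map_mat h y"
      by (rule mat_ring_eqI[where n = n]) (use xy in \<open>auto simp: dim d m[OF dim(2)] idx iff\<close>)
  next
    have m: "map_mat h X $$ (i, j) = h (X $$ (i, j))" if "X \<in> carrier_mat n n" "i < n" "j < n" for X i j
      using that by auto
    show "map_mat h \<one>\<^bsub>?M\<^esub> = \<one>\<^bsub>?N\<^esub>"
      by (rule mat_ring_eqI[where n = n]) (auto simp: dim m[OF dim(4)] idx)
  qed
qed

section \<open>Matrices over the prime radical\<close>

definition mat_over :: "'a set \<Rightarrow> nat \<Rightarrow> 'a mat set" where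
  "mat_over I n = {A \<in> carrier_mat n n. \<forall>i<n. \<forall>j<n. A $$ (i, j) \<in> I}"

lemma carrier_mat_ring: "carrier (mat_ring R n) = mat_over (carrier R) n"
  by (auto simp: mat_over_def mat_ring_carrier_iff)

lemma (in ideal) finsum_in_ideal:
  assumes "finite A" "f \<in> A \<rightarrow> I"
  shows "(\<Oplus>i\<in>A. f i) \<in> I"
  using assms
proof (induction A rule: finite_induct)
  case (insert a A)
  then have "f \<in> A \<rightarrow> carrier R" "f a \<in> carrier R" using a_subset by blast+
  with insert show ?case by (auto simp: finsum_insert)
qed simp

text \<open>
  Both factors are congruent modulo \<open>Q\<close> to elements of \<open>I\<close> and \<open>J\<close>. This is how primeness of an
  ideal enters through products of ideals.
\<close>

lemma (in ring) mult_sum_ideals: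
  assumes "ideal Q R" "ideal I R" "ideal J R" "ideal_prod R I J \<subseteq> Q"
    and "u \<in> Q <+>\<^bsub>R\<^esub> I" "v \<in> Q <+>\<^bsub>R\<^esub> J"
  shows "u \<otimes> v \<in> Q"
proof -
  interpret Q: ideal Q R by fact
  interpret I: ideal I R by fact
  interpret J: ideal J R by fact
  obtain p a where u: "p \<in> Q" "a \<in> I" "u = p \<oplus> a"
    using assms(5) by (auto simp: set_add_def' )
  obtain q b where v: "q \<in> Q" "b \<in> J" "v = q \<oplus> b"
    using assms(6) by (auto simp: set_add_def')
  have c: "p \<in> carrier R" "a \<in> carrier R" "q \<in> carrier R" "b \<in> carrier R"
    using u v Q.Icarr I.Icarr J.Icarr by auto
  have "a \<otimes> b \<in> Q"
    using ideal_prod.prod[of a I b J R] u v assms(4) by auto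
  moreover have "u \<otimes> v = p \<otimes> (q \<oplus> b) \<oplus> (a \<otimes> q \<oplus> a \<otimes> b)"
    using c unfolding u(3) v(3) by (simp add: l_distr r_distr a_ac)
  moreover have "p \<otimes> (q \<oplus> b) \<in> Q" "a \<otimes> q \<in> Q"
    using u v c by (simp_all add: Q.I_r_closed Q.I_l_closed)
  ultimately show ?thesis
    using Q.a_closed by simp
qed

text \<open>
  If no power of \<open>X\<close> is zero, then by Zorn's lemma there is an ideal \<open>Q\<close> of \<open>R\<close> maximal among those
  for which no power of \<open>X\<close> has all its entries in \<open>Q\<close>. It is prime: two ideals not contained in \<open>Q\<close>
  enlarge \<open>Q\<close> enough to contain the entries of \<open>X^k\<close> and of \<open>X^l\<close>, and if their product were
  contained in \<open>Q\<close>, then \<open>X^(k + l)\<close> would have its entries in \<open>Q\<close>. But the prime radical lies in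
  \<open>Q\<close>, and with it the entries of \<open>X\<close> itself.
\<close>

lemma (in ring) mat_over_prime_radical_nilpotent:
  assumes X: "X \<in> mat_over (baer_mccoy_radical R) n"
  shows "nilpotent (mat_ring R n) X"
proof (rule ccontr)
  let ?M = "mat_ring R n"
  interpret M: ring ?M by (rule mat_ring_ring)
  assume not_nil: "\<not> nilpotent ?M X"
  have XM: "X \<in> carrier ?M"
    using X by (auto simp: carrier_mat_ring mat_over_def baer_mccoy_radical_def)
  then have pow_dim: "X [^]\<^bsub>?M\<^esub> (k::nat) \<in> carrier ?M" for k by simp
  have pow_nz: "X [^]\<^bsub>?M\<^esub> (k::nat) \<noteq> \<zero>\<^bsub>?M\<^esub>" for k
    using not_nil XM by (auto simp: nilpotent_def)
  define \<F> where "\<F> = {I. ideal I R \<and> (\<forall>k::nat. X [^]\<^bsub>?M\<^esub> k \<notin> mat_over I n)}"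
  have "{\<zero>} \<in> \<F>"
  proof -
    have "X [^]\<^bsub>?M\<^esub> k = \<zero>\<^bsub>?M\<^esub>" if "X [^]\<^bsub>?M\<^esub> k \<in> mat_over {\<zero>} n" for k :: nat
      using that by (intro mat_ring_eqI[where n = n]) (auto simp: mat_over_def mat_ring_dim mat_ring_index)
    then show ?thesis using pow_nz zeroideal by (auto simp: \<F>_def)
  qed
  moreover have "\<Union>C \<in> \<F>" if C: "C \<noteq> {}" "subset.chain \<F> C" for C
  proof -
    have ideals: "ideal I R" if "I \<in> C" for I
      using C that by (auto simp: \<F>_def subset_chain_def)
    have "subset.chain {I. ideal I R} C"
      using C ideals by (auto simp: subset_chain_def)
    then have "ideal (\<Union>C) R"
      using chain_Union_is_ideal[of C] C(1) by simp
    moreover have "X [^]\<^bsub>?M\<^esub> k \<notin> mat_over (\<Union>C) n" for k :: nat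
    proof
      assume k: "X [^]\<^bsub>?M\<^esub> k \<in> mat_over (\<Union>C) n"
      \<comment> \<open>A matrix has finitely many entries, so one member of the chain contains all of them.\<close>
      have "(\<lambda>(i, j). (X [^]\<^bsub>?M\<^esub> k) $$ (i, j)) ` ({..<n} \<times> {..<n}) \<subseteq> \<Union>C"
        (is "?E \<subseteq> _") using k by (auto simp: mat_over_def)
      moreover have "finite ?E" by simp
      ultimately obtain I where "I \<in> C" "(\<lambda>(i, j). (X [^]\<^bsub>?M\<^esub> k) $$ (i, j)) ` ({..<n} \<times> {..<n}) \<subseteq> I"
        using C by (elim finite_subset_Union_chain)
      then have "X [^]\<^bsub>?M\<^esub> k \<in> mat_over I n" "I \<in> \<F>"
        using k C by (auto simp: mat_over_def subset_chain_def)
      then show False by (auto simp: \<F>_def)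
    qed
    ultimately show ?thesis by (simp add: \<F>_def)
  qed
  ultimately obtain Q where Q: "Q \<in> \<F>" and max: "\<And>I. I \<in> \<F> \<Longrightarrow> Q \<subseteq> I \<Longrightarrow> I = Q"
    using subset_Zorn_nonempty[of \<F>] by blast
  interpret Q: ideal Q R using Q by (simp add: \<F>_def)
  have enlarge: "\<exists>k::nat. X [^]\<^bsub>?M\<^esub> k \<in> mat_over (Q <+>\<^bsub>R\<^esub> I) n" if I: "ideal I R" "\<not> I \<subseteq> Q" for I
  proof -
    interpret I: ideal I R by fact
    have "Q \<subseteq> Q <+>\<^bsub>R\<^esub> I"
    proof
      fix q assume "q \<in> Q"
      then have "q = q \<oplus> \<zero>" "q \<in> Q" using Q.Icarr by auto
      then show "q \<in> Q <+>\<^bsub>R\<^esub> I" unfolding set_add_def' using I.zero_closed by blast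
    qed
    moreover have "I \<subseteq> Q <+>\<^bsub>R\<^esub> I"
    proof
      fix a assume "a \<in> I"
      then have "a = \<zero> \<oplus> a" "a \<in> I" using I.Icarr by auto
      then show "a \<in> Q <+>\<^bsub>R\<^esub> I" unfolding set_add_def' using Q.zero_closed by blast
    qed
    ultimately have "Q <+>\<^bsub>R\<^esub> I \<notin> \<F>" using max[of "Q <+>\<^bsub>R\<^esub> I"] I(2) by blast
    then show ?thesis
      using add_ideals[OF Q.ideal_axioms I(1)] by (auto simp: \<F>_def)
  qed
  have "nc_prime_ideal R Q"
    unfolding nc_prime_ideal_def
  proof (intro conjI allI impI)
    show "ideal Q R" by (rule Q.ideal_axioms)
    \<comment> \<open>The power \<open>X^0\<close> has all its entries in \<open>R\<close>.\<close>
    show "Q \<noteq> carrier R"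
      using Q pow_dim by (auto simp: \<F>_def carrier_mat_ring)
    fix I J assume I: "ideal I R" and J: "ideal J R" and prod: "ideal_prod R I J \<subseteq> Q"
    show "I \<subseteq> Q \<or> J \<subseteq> Q"
    proof (rule ccontr)
      assume "\<not> (I \<subseteq> Q \<or> J \<subseteq> Q)"
      then obtain k l :: nat where k: "X [^]\<^bsub>?M\<^esub> k \<in> mat_over (Q <+>\<^bsub>R\<^esub> I) n"
        and l: "X [^]\<^bsub>?M\<^esub> l \<in> mat_over (Q <+>\<^bsub>R\<^esub> J) n"
        using enlarge I J by meson
      have "X [^]\<^bsub>?M\<^esub> (k + l) = X [^]\<^bsub>?M\<^esub> k \<otimes>\<^bsub>?M\<^esub> X [^]\<^bsub>?M\<^esub> l"
        using XM by (simp add: M.nat_pow_mult)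
      moreover have "X [^]\<^bsub>?M\<^esub> k \<otimes>\<^bsub>?M\<^esub> X [^]\<^bsub>?M\<^esub> l \<in> mat_over Q n"
        using k l mult_sum_ideals[OF Q.ideal_axioms I J prod]
        by (auto simp: mat_over_def mat_ring_dim mat_ring_index intro!: Q.finsum_in_ideal)
      ultimately have "X [^]\<^bsub>?M\<^esub> (k + l) \<in> mat_over Q n" by simp
      then show False using Q unfolding \<F>_def by blast
    qed
  qed
  then have "X [^]\<^bsub>?M\<^esub> (1::nat) \<in> mat_over Q n"
    using X XM M.nat_pow_eone[OF XM] by (auto simp: mat_over_def baer_mccoy_radical_def)
  then show False using Q unfolding \<F>_def by blast
qed

lemma (in ring) baer_mccoy_radical_ideal: "ideal (baer_mccoy_radical R) R"
proof -
  have "baer_mccoy_radical R = \<Inter> (insert (carrier R) {P. nc_prime_ideal R P})"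
    by (simp add: baer_mccoy_radical_def)
  moreover have "ideal \<dots> R"
    by (rule i_Intersect) (auto simp: oneideal nc_prime_ideal_def)
  ultimately show ?thesis by simp
qed

section \<open>Evaluating polynomials in a ring\<close>

text \<open>
  Identities between polynomials in commuting elements of a noncommutative ring are proved in a
  polynomial ring over the integers, which is a type of class \<^class>\<open>idom\<close> where they can be decided
  by Groebner bases, and are then transported along an evaluation homomorphism. The locale describes
  such homomorphisms from a type to a ring with a carrier.
\<close>

locale ring_eval = ring R for R (structure) +
  fixes \<phi> :: "'c :: idom \<Rightarrow> 'a"
  assumes closed [simp]: "\<phi> x \<in> carrier R"
    and add: "\<phi> (x + y) = \<phi> x \<oplus> \<phi> y"
    and mult: "\<phi> (x * y) = \<phi> x \<otimes> \<phi> y"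
    and one: "\<phi> 1 = \<one>"
begin

lemma zero: "\<phi> 0 = \<zero>"
  using add[of 0 0] by simp

lemma uminus: "\<phi> (- x) = \<ominus> \<phi> x"
  using add[of "- x" x] by (simp add: zero minus_equality)

lemma diff: "\<phi> (x - y) = \<phi> x \<ominus> \<phi> y"
  using add[of x "- y"] by (simp add: uminus a_minus_def)

lemma power: "\<phi> (x ^ k) = \<phi> x [^] k"
  by (induction k) (simp_all add: one mult power_Suc2 del: power_Suc)

lemma commute: "\<phi> x \<otimes> \<phi> y = \<phi> y \<otimes> \<phi> x"
  using mult[of x y] mult[of y x] by (simp add: mult.commute)

lemma dvd_zero:
  assumes "\<phi> f = \<zero>" "f dvd g"
  shows "\<phi> g = \<zero>"
  using assms by (auto simp: mult elim!: dvdE)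

end

text \<open>
  The extension of \<open>\<phi>\<close> to polynomials that sends the variable to \<open>x\<close>. Iterating it gives
  evaluation of polynomials in several commuting elements.
\<close>

definition (in ring_eval) adjoin :: "'a \<Rightarrow> 'c poly \<Rightarrow> 'a" where
  "adjoin x p = fold_coeffs (\<lambda>a b. \<phi> a \<oplus> x \<otimes> b) p \<zero>"

text \<open>
  Polynomial multiplication lets the variable pass the coefficients, so \<open>x\<close> has to commute with
  their images.
\<close>

lemma (in ring_eval)
  assumes x: "x \<in> carrier R" and comm: "\<And>c. x \<otimes> \<phi> c = \<phi> c \<otimes> x"
  shows ring_eval_adjoin: "ring_eval R (adjoin x)"
    and adjoin_const: "adjoin x [:c:] = \<phi> c"
    and adjoin_X: "adjoin x [:0, 1:] = x"
proof -
  have e0: "adjoin x 0 = \<zero>" by (simp add: adjoin_def)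
  have eC: "adjoin x (pCons a p) = \<phi> a \<oplus> x \<otimes> adjoin x p" for a p
    using x by (cases "a = 0 \<and> p = 0") (auto simp: adjoin_def zero)
  have cl: "adjoin x p \<in> carrier R" for p
    by (induction p) (use x in \<open>auto simp: e0 eC\<close>)
  have ad: "adjoin x (p + q) = adjoin x p \<oplus> adjoin x q" for p q
  proof (induction p q rule: poly_induct2)
    case (pCons a p b q)
    then show ?case using x cl by (simp add: eC add r_distr a_ac)
  qed (simp add: e0)
  have sm: "adjoin x (smult c p) = \<phi> c \<otimes> adjoin x p" for c p
  proof (induction p)
    case (pCons a p)
    have "x \<otimes> (\<phi> c \<otimes> adjoin x p) = \<phi> c \<otimes> (x \<otimes> adjoin x p)"
      using x cl comm[of c] by (simp flip: m_assoc)
    then show ?case using pCons x cl by (simp add: eC mult r_distr)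
  qed (simp add: e0)
  have ml: "adjoin x (p * q) = adjoin x p \<otimes> adjoin x q" for p q
  proof (induction p)
    case (pCons a p)
    then show ?case
      using x cl by (simp add: ad sm eC zero l_distr m_assoc)
  qed (simp add: e0 cl)
  show "ring_eval R (adjoin x)"
    by unfold_locales (use x in \<open>auto simp: cl ad ml one_pCons eC e0 one\<close>)
  show "adjoin x [:c:] = \<phi> c" "adjoin x [:0, 1:] = x"
    using x by (simp_all add: eC e0 zero one)
qed

lemma (in ring) ring_eval_int: "ring_eval R (\<lambda>k :: int. add_pow R k \<one>)"
proof
  fix k l :: int
  show "add_pow R k \<one> \<in> carrier R" by simp
  show "add_pow R (k + l) \<one> = add_pow R k \<one> \<oplus> add_pow R l \<one>" by (simp add: add.int_pow_mult)
  show "add_pow R (k * l) \<one> = add_pow R k \<one> \<otimes> add_pow R l \<one>"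
    using add.int_pow_pow[of \<one> k l] by (simp add: add_pow_ldistr_int mult.commute)
  show "add_pow R (1 :: int) \<one> = \<one>" using add.int_pow_1[of \<one>] by simp
qed

lemma (in ring_eval) of_nat: "\<phi> (of_nat k) = add_pow R k \<one>"
  by (induction k) (simp_all add: zero one add a_comm)

text \<open>
  Supplies the commutation hypothesis for adjoining a second element \<open>y\<close>.
\<close>

lemma (in ring_eval) commute_adjoin:
  assumes x: "x \<in> carrier R" and y: "y \<in> carrier R" and xy: "y \<otimes> x = x \<otimes> y"
    and comm: "\<And>c. x \<otimes> \<phi> c = \<phi> c \<otimes> x" "\<And>c. y \<otimes> \<phi> c = \<phi> c \<otimes> y"
  shows "y \<otimes> adjoin x p = adjoin x p \<otimes> y"
proof -
  interpret X: ring_eval R "adjoin x" by (rule ring_eval_adjoin[OF x comm(1)])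
  note cX = adjoin_const[OF x comm(1)] adjoin_X[OF x comm(1)]
  show ?thesis
  proof (induction p)
    case 0
    then show ?case using y by (simp add: X.zero)
  next
    case (pCons a p)
    have "pCons a p = [:a:] + [:0, 1:] * p" by simp
    then have "adjoin x (pCons a p) = \<phi> a \<oplus> x \<otimes> adjoin x p"
      by (simp only: X.add X.mult cX)
    moreover have "y \<otimes> (x \<otimes> adjoin x p) = x \<otimes> adjoin x p \<otimes> y"
      using x y xy pCons.IH m_assoc[of y x "adjoin x p"] m_assoc[of x y "adjoin x p"]
        m_assoc[of x "adjoin x p" y] by simp
    ultimately show ?case using x y comm(2) by (simp add: l_distr r_distr)
  qed
qed

definition (in ring) int_poly_eval :: "'a \<Rightarrow> int poly \<Rightarrow> 'a" where
  "int_poly_eval = ring_eval.adjoin R (\<lambda>k :: int. add_pow R k \<one>)"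

lemma (in ring)
  assumes x: "x \<in> carrier R"
  shows int_poly_eval: "ring_eval R (int_poly_eval x)"
    and int_poly_eval_const: "int_poly_eval x [:k:] = add_pow R k \<one>"
    and int_poly_eval_X: "int_poly_eval x [:0, 1:] = x"
  using ring_eval.ring_eval_adjoin[OF ring_eval_int x]
    ring_eval.adjoin_const[OF ring_eval_int x] ring_eval.adjoin_X[OF ring_eval_int x] x
  by (simp_all add: int_poly_eval_def add_pow_ldistr_int add_pow_rdistr_int)

section \<open>Lifting tripotents modulo a nil ideal\<close>

text \<open>
  A difference \<open>e = g - h\<close> of orthogonal idempotents. If 2 is invertible every tripotent has this form;
  in general this is the kind of tripotent that can be lifted modulo a nil ideal. The difference is
  written as \<open>e + h = g\<close> so that additive and multiplicative maps visibly preserve the property.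
\<close>

definition split_tripotent :: "('a, 'b) ring_scheme \<Rightarrow> 'a \<Rightarrow> bool" where
  "split_tripotent R e \<longleftrightarrow> e \<in> carrier R \<and>
     (\<exists>g\<in>carrier R. \<exists>h\<in>carrier R. g \<otimes>\<^bsub>R\<^esub> g = g \<and> h \<otimes>\<^bsub>R\<^esub> h = h \<and>
        g \<otimes>\<^bsub>R\<^esub> h = \<zero>\<^bsub>R\<^esub> \<and> h \<otimes>\<^bsub>R\<^esub> g = \<zero>\<^bsub>R\<^esub> \<and> e \<oplus>\<^bsub>R\<^esub> h = g)"

definition tripotent_nil_sum :: "('a, 'b) ring_scheme \<Rightarrow> 'a \<Rightarrow> bool" where
  "tripotent_nil_sum R a \<longleftrightarrow> (\<exists>e f w. split_tripotent R e \<and> split_tripotent R f \<and>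
     nilpotent R w \<and> a = e \<oplus>\<^bsub>R\<^esub> f \<oplus>\<^bsub>R\<^esub> w)"

lemma (in ring) split_tripotent_imp_tripotent:
  assumes "split_tripotent R e"
  shows "tripotent R e"
proof -
  obtain g h where gh: "g \<in> carrier R" "h \<in> carrier R" "g \<otimes> g = g" "h \<otimes> h = h"
      "g \<otimes> h = \<zero>" "h \<otimes> g = \<zero>" "e \<oplus> h = g" and e: "e \<in> carrier R"
    using assms by (auto simp: split_tripotent_def)
  have eg: "e = g \<oplus> \<ominus> h"
    using gh e a_assoc[of e h "\<ominus> h"] by (simp add: r_neg)
  have "e \<otimes> e = g \<oplus> h"
    unfolding eg using gh by (simp add: l_distr r_distr l_minus r_minus)
  then have "e \<otimes> e \<otimes> e = e"
    unfolding eg using gh by (simp add: l_distr r_distr l_minus r_minus)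
  then show ?thesis using e by (simp add: tripotent_def numeral_3_eq_3)
qed

text \<open>
  The polynomial \<open>q\<close> that turns an approximate idempotent \<open>x\<close> into an idempotent: \<open>q\<close> is divisible by
  \<open>x^k\<close> and \<open>1 - q\<close> by \<open>(1 - x)^k\<close>, so \<open>q\<close> is idempotent as soon as \<open>(x - x\<^sup>2)^k = 0\<close>, while \<open>q = x\<close>
  wherever \<open>x\<close> is idempotent already.
\<close>

lemma idempotent_polynomial:
  fixes x :: "'a :: comm_ring_1"
  assumes "k > 0"
  defines "q \<equiv> 1 - (1 - x ^ k) ^ k"
  shows "x dvd q" "(x - x\<^sup>2) ^ k dvd q - q\<^sup>2" "x - x\<^sup>2 dvd q - x"
proof -
  have pow: "1 - u dvd 1 - u ^ j" for u :: 'a and j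
    by (metis dvd_triv_left one_diff_power_eq)
  have "x ^ k dvd q"
    using pow[of "1 - x ^ k" k] by (simp add: q_def)
  then show "x dvd q"
    using assms(1) by (meson dvd_power dvd_trans)
  have "(1 - x) ^ k dvd 1 - q"
    using pow[of x k] by (simp add: q_def dvd_power_same)
  with \<open>x ^ k dvd q\<close> have "x ^ k * (1 - x) ^ k dvd q * (1 - q)"
    by (rule mult_dvd_mono)
  then show "(x - x\<^sup>2) ^ k dvd q - q\<^sup>2"
    by (simp add: power2_eq_square algebra_simps flip: power_mult_distrib)
  have idem: "u - u\<^sup>2 dvd u - u ^ j" if j: "j > 0" for u :: 'a and j
  proof -
    obtain i where "j = Suc i" using j gr0_implies_Suc by blast
    then have "u - u ^ j = u * (1 - u ^ i)" by (simp add: algebra_simps)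
    moreover have "u - u\<^sup>2 = u * (1 - u)" by (simp add: power2_eq_square algebra_simps)
    ultimately show ?thesis using mult_dvd_mono[OF dvd_refl pow[of u i]] by metis
  qed
  have "x - x\<^sup>2 dvd (1 - x) - (1 - x) ^ k"
    using idem[OF assms(1), of "1 - x"] by (simp add: power2_eq_square algebra_simps)
  moreover have "x - x\<^sup>2 dvd (1 - x) ^ k - (1 - x ^ k) ^ k"
  proof -
    have "a - b dvd a ^ j - b ^ j" for a b :: 'a and j
      unfolding power_diff_sumr2 by (rule dvd_triv_left)
    from this[of "1 - x" "1 - x ^ k" k] have "x ^ k - x dvd (1 - x) ^ k - (1 - x ^ k) ^ k"
      by simp
    moreover have "x - x\<^sup>2 dvd x ^ k - x"
      using idem[OF assms(1), of x] dvd_minus_iff[of "x - x\<^sup>2" "x - x ^ k"] by simp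
    ultimately show ?thesis by (rule dvd_trans[rotated])
  qed
  ultimately have "x - x\<^sup>2 dvd ((1 - x) - (1 - x) ^ k) + ((1 - x) ^ k - (1 - x ^ k) ^ k)"
    by (rule dvd_add)
  then show "x - x\<^sup>2 dvd q - x" by (simp add: q_def algebra_simps)
qed

text \<open>
  The lift \<open>y\<close> is a polynomial in \<open>x\<close> without constant term; the factorizations \<open>y = x z = z x\<close>
  record this and make \<open>y\<close> inherit every orthogonality relation of \<open>x\<close>.
\<close>

lemma (in ring_hom_ring) lift_idempotent:
  assumes nil: "\<And>x. x \<in> carrier R \<Longrightarrow> h x = \<zero>\<^bsub>S\<^esub> \<Longrightarrow> nilpotent R x"
    and x: "x \<in> carrier R" and idem: "h x \<otimes>\<^bsub>S\<^esub> h x = h x"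
  obtains y z where "y \<in> carrier R" "z \<in> carrier R" "y \<otimes> y = y" "h y = h x" "y = x \<otimes> z" "y = z \<otimes> x"
proof -
  interpret E: ring_eval R "R.int_poly_eval x" by (rule R.int_poly_eval[OF x])
  let ?E = "R.int_poly_eval x" and ?X = "[:0, 1:] :: int poly"
  note EX = R.int_poly_eval_X[OF x]
  have "?E (?X - ?X\<^sup>2) = x \<ominus> x \<otimes> x"
    by (simp only: E.diff power2_eq_square E.mult EX)
  moreover have "h (x \<ominus> x \<otimes> x) = \<zero>\<^bsub>S\<^esub>"
    using x idem by (simp add: R.minus_eq S.r_neg)
  ultimately have ker: "h (?E (?X - ?X\<^sup>2)) = \<zero>\<^bsub>S\<^esub>" by simp
  obtain j :: nat where "?E (?X - ?X\<^sup>2) [^] j = \<zero>"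
    using nil[OF E.closed ker] by (auto simp: nilpotent_def)
  then have "?E ((?X - ?X\<^sup>2) ^ Suc j) = \<zero>" by (simp add: E.power R.nat_pow_Suc del: power_Suc)
  define q where "q = 1 - (1 - ?X ^ Suc j) ^ Suc j"
  note q = idempotent_polynomial[of "Suc j" ?X, folded q_def]
  have "?E (q - q\<^sup>2) = \<zero>"
    using E.dvd_zero[OF \<open>?E ((?X - ?X\<^sup>2) ^ Suc j) = \<zero>\<close>] q(2) by simp
  then have "?E q \<ominus> ?E q \<otimes> ?E q = \<zero>"
    by (simp only: E.diff power2_eq_square E.mult)
  then have "?E q = ?E q \<otimes> ?E q" by simp
  then have "?E q \<otimes> ?E q = ?E q" by (rule sym)
  moreover obtain r where r: "q = ?X * r" using q(1) by (auto elim: dvdE)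
  moreover obtain s where s: "q - ?X = (?X - ?X\<^sup>2) * s" using q(3) by (auto elim: dvdE)
  have "?E q \<ominus> x = ?E (?X - ?X\<^sup>2) \<otimes> ?E s"
    using arg_cong[OF s, of ?E] by (simp only: E.mult E.diff[of q] EX)
  then have "h (?E q \<ominus> x) = \<zero>\<^bsub>S\<^esub>"
    using ker by (simp only: hom_mult[OF E.closed E.closed] S.l_null[OF hom_closed[OF E.closed]])
  then have "h (?E q) \<ominus>\<^bsub>S\<^esub> h x = \<zero>\<^bsub>S\<^esub>"
    using x by (simp add: R.minus_eq S.minus_eq)
  then have "h (?E q) = h x" using x by simp
  moreover have "?E q = x \<otimes> ?E r" "?E q = ?E r \<otimes> x"
    unfolding r by (simp_all only: E.mult EX mult.commute[of ?X]) (metis E.commute EX)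
  ultimately show ?thesis using that E.closed by blast
qed

text \<open>
  After lifting \<open>g\<close> to \<open>g1\<close>, the second idempotent is lifted inside the corner of \<open>1 - g1\<close>, where it
  is orthogonal to \<open>g1\<close>.
\<close>

lemma (in ring_hom_ring) lift_split_tripotent:
  assumes nil: "\<And>x. x \<in> carrier R \<Longrightarrow> h x = \<zero>\<^bsub>S\<^esub> \<Longrightarrow> nilpotent R x"
    and surj: "h ` carrier R = carrier S"
    and e: "split_tripotent S e"
  obtains e' where "split_tripotent R e'" "h e' = e"
proof -
  obtain g k where gk: "g \<in> carrier S" "k \<in> carrier S" "g \<otimes>\<^bsub>S\<^esub> g = g" "k \<otimes>\<^bsub>S\<^esub> k = k"
      "g \<otimes>\<^bsub>S\<^esub> k = \<zero>\<^bsub>S\<^esub>" "k \<otimes>\<^bsub>S\<^esub> g = \<zero>\<^bsub>S\<^esub>" "e \<oplus>\<^bsub>S\<^esub> k = g" and ec: "e \<in> carrier S"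
    using e by (auto simp: split_tripotent_def)
  obtain g0 k0 where 0: "g0 \<in> carrier R" "h g0 = g" "k0 \<in> carrier R" "h k0 = k"
    using gk surj by (metis imageE)
  obtain g1 z where g1: "g1 \<in> carrier R" "g1 \<otimes> g1 = g1" "h g1 = g"
    using lift_idempotent[OF nil, of g0] 0 gk by metis
  define p where "p = \<one> \<ominus> g1"
  have p: "p \<in> carrier R" "g1 \<otimes> p = \<zero>" "p \<otimes> g1 = \<zero>" "h p = \<one>\<^bsub>S\<^esub> \<ominus>\<^bsub>S\<^esub> g"
    using g1 by (simp_all add: p_def R.minus_eq S.minus_eq R.l_distr R.r_distr R.l_minus R.r_minus R.r_neg)
  have "h (p \<otimes> k0 \<otimes> p) = k"
    using 0 p gk by (simp add: S.minus_eq S.l_distr S.r_distr S.l_minus S.r_minus)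
  then obtain k1 z where k1: "k1 \<in> carrier R" "k1 \<otimes> k1 = k1" "h k1 = k" "z \<in> carrier R"
      "k1 = p \<otimes> k0 \<otimes> p \<otimes> z" "k1 = z \<otimes> (p \<otimes> k0 \<otimes> p)"
    using lift_idempotent[OF nil, of "p \<otimes> k0 \<otimes> p"] 0 p gk by (metis R.m_closed)
  have "g1 \<otimes> k1 = \<zero>"
    unfolding k1(5) using g1 p 0 k1(4) by (simp flip: R.m_assoc)
  moreover have "k1 \<otimes> g1 = \<zero>"
    unfolding k1(6) using g1 p 0 k1(4) by (simp add: R.m_assoc)
  moreover have "g1 \<ominus> k1 \<oplus> k1 = g1"
    using g1 k1 by (simp add: R.minus_eq R.a_assoc R.l_neg)
  ultimately have "split_tripotent R (g1 \<ominus> k1)"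
    unfolding split_tripotent_def using g1 k1(1,2) by auto
  moreover have "h (g1 \<ominus> k1) = e"
  proof -
    have "e \<oplus>\<^bsub>S\<^esub> k \<oplus>\<^bsub>S\<^esub> \<ominus>\<^bsub>S\<^esub> k = e"
      using gk(2) ec by (simp add: S.a_assoc S.r_neg)
    then show ?thesis using g1 k1(1,3) gk by (simp add: R.minus_eq)
  qed
  ultimately show ?thesis by (rule that)
qed

theorem (in ring_hom_ring) lift_tripotent_nil_sum:
  assumes nil: "\<And>x. x \<in> carrier R \<Longrightarrow> h x = \<zero>\<^bsub>S\<^esub> \<Longrightarrow> nilpotent R x"
    and surj: "h ` carrier R = carrier S"
    and a: "a \<in> carrier R" and "tripotent_nil_sum S (h a)"
  shows "tripotent_nil_sum R a"
proof -
  obtain e' f' w' where d: "split_tripotent S e'" "split_tripotent S f'" "nilpotent S w'"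
      "h a = e' \<oplus>\<^bsub>S\<^esub> f' \<oplus>\<^bsub>S\<^esub> w'"
    using assms(4) by (auto simp: tripotent_nil_sum_def)
  obtain e where e: "split_tripotent R e" "h e = e'"
    using lift_split_tripotent[OF nil surj d(1)] by blast
  obtain f where f: "split_tripotent R f" "h f = f'"
    using lift_split_tripotent[OF nil surj d(2)] by blast
  have c: "e \<in> carrier R" "f \<in> carrier R" "w' \<in> carrier S"
    using e f d by (auto simp: split_tripotent_def nilpotent_def)
  define w where "w = \<ominus> (e \<oplus> f) \<oplus> a"
  have w: "w \<in> carrier R" "a = e \<oplus> f \<oplus> w"
    using a c by (simp_all add: w_def R.r_neg flip: R.a_assoc R.minus_add)
  have "h w = \<ominus>\<^bsub>S\<^esub> (e' \<oplus>\<^bsub>S\<^esub> f') \<oplus>\<^bsub>S\<^esub> (e' \<oplus>\<^bsub>S\<^esub> f' \<oplus>\<^bsub>S\<^esub> w')"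
    using a c e f d by (simp add: w_def)
  also have "\<dots> = w'"
    using c e f hom_closed S.r_neg1[of "e' \<oplus>\<^bsub>S\<^esub> f'" w'] by auto
  finally obtain k :: nat where "h w [^]\<^bsub>S\<^esub> k = \<zero>\<^bsub>S\<^esub>"
    using d(3) by (auto simp: nilpotent_def)
  then have "nilpotent R (w [^] k)"
    using w nil[of "w [^] k"] by (simp add: hom_nat_pow)
  then have "nilpotent R w"
    using w by (auto simp: nilpotent_def R.nat_pow_pow)
  then show ?thesis
    using e f w by (auto simp: tripotent_nil_sum_def)
qed

section \<open>Rings in which every element satisfies x^5 = x\<close>

text \<open>
  The only fields satisfying \<open>x^5 = x\<close> are those with 2, 3 and 5 elements. The identities are the
  traces of this fact: the characteristic divides 30, multiplication by 15 and by 10 isolates the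
  parts of characteristic 2 and 3, where \<open>q\<^sup>2 = q\<close> and \<open>q^3 = q\<close>, and every element takes a value
  among \<open>0, ..., 4\<close>. Each is an explicit combination of instances of \<open>p q = q^5 - q\<close>, found by
  comparing \<open>p\<close> at \<open>q\<close>, \<open>q + 1\<close>, \<open>- q\<close> and \<open>1 - q\<close>.
\<close>

lemma (in ring_eval) quintic_identities:
  assumes quint: "\<And>q. \<phi> (q ^ 5) = \<phi> q"
  shows "\<phi> 30 = \<zero>" "\<phi> (15 * (q\<^sup>2 - q)) = \<zero>" "\<phi> (10 * (q ^ 3 - q)) = \<zero>"
    "\<phi> (q * (q - 1) * (q - 2) * (q - 3) * (q - 4)) = \<zero>"
proof -
  define p where "p q = q ^ 5 - q" for q :: 'c
  have p: "\<phi> (p q) = \<zero>" for q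
    by (simp add: p_def diff quint r_neg minus_eq)
  have "30 = p 2" by (simp add: p_def)
  with p show 30: "\<phi> 30 = \<zero>" by metis
  have 15: "\<phi> (15 * (q\<^sup>2 - q)) = \<zero>" for q
  proof -
    have "15 * (q\<^sup>2 - q) = 15 * p q - q * (3 * (p (q + 1) - p q) - 30 * (q ^ 3 + q\<^sup>2 + q))"
      unfolding p_def by Groebner_Basis.algebra
    also have "\<phi> \<dots> = \<zero>"
      by (simp only: diff mult p 30) (simp add: minus_eq)
    finally show ?thesis .
  qed
  then show "\<phi> (15 * (q\<^sup>2 - q)) = \<zero>" .
  have 10: "\<phi> (10 * (q ^ 3 - q)) = \<zero>" for q
  proof -
    have "10 * (q ^ 3 - q) = 2 * ((p (q + 1) - p q) - (p (1 - q) - p (- q))) - 30 * (q ^ 3 + q)"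
      unfolding p_def by Groebner_Basis.algebra
    also have "\<phi> \<dots> = \<zero>"
      by (simp only: diff mult p 30) (simp add: minus_eq)
    finally show ?thesis .
  qed
  then show "\<phi> (10 * (q ^ 3 - q)) = \<zero>" .
  let ?Q = "q * (q - 1) * (q - 2) * (q - 3) * (q - 4)"
  have "?Q = 6 * p q - (q - q\<^sup>2) * (10 * (q ^ 3 - q)) - (- (q ^ 3) - q\<^sup>2) * (15 * (q\<^sup>2 - q))
      - 30 * (?Q + 10 * q ^ 4 - 37 * q ^ 3 + 52 * q\<^sup>2 - 25 * q)"
    unfolding p_def by Groebner_Basis.algebra
  also have "\<phi> \<dots> = \<zero>"
    by (simp only: diff[of _ "_ * _"] mult[of _ "p _"] mult[of _ "10 * (q ^ 3 - q)"]
        mult[of _ "15 * (q\<^sup>2 - q)"] mult[of 30] p 10 15 30) (simp add: minus_eq)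
  finally show "\<phi> ?Q = \<zero>" .
qed

text \<open>
  The elements \<open>e y (1 - e)\<close> and \<open>(1 - e) y e\<close> have square zero.
\<close>

lemma (in ring) idempotent_central:
  assumes red: "\<And>x. x \<in> carrier R \<Longrightarrow> x \<otimes> x = \<zero> \<Longrightarrow> x = \<zero>"
    and e: "e \<in> carrier R" "e \<otimes> e = e" and y: "y \<in> carrier R"
  shows "e \<otimes> y = y \<otimes> e"
proof -
  define d where "d = \<one> \<ominus> e"
  have d: "d \<in> carrier R" "d \<otimes> e = \<zero>" "e \<otimes> d = \<zero>"
    using e by (simp_all add: d_def minus_eq l_distr r_distr l_minus r_minus r_neg)
  have "(e \<otimes> y \<otimes> d) \<otimes> (e \<otimes> y \<otimes> d) = e \<otimes> y \<otimes> (d \<otimes> e) \<otimes> (y \<otimes> d)"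
    using e d(1) y by (simp only: m_assoc m_closed)
  then have "e \<otimes> y \<otimes> d = \<zero>" using red[of "e \<otimes> y \<otimes> d"] e d y by simp
  then have 1: "e \<otimes> y \<ominus> e \<otimes> y \<otimes> e = \<zero>"
    using e y by (simp add: d_def minus_eq r_distr r_minus)
  have "(d \<otimes> y \<otimes> e) \<otimes> (d \<otimes> y \<otimes> e) = d \<otimes> y \<otimes> (e \<otimes> d) \<otimes> (y \<otimes> e)"
    using e d(1) y by (simp only: m_assoc m_closed)
  then have "d \<otimes> y \<otimes> e = \<zero>" using red[of "d \<otimes> y \<otimes> e"] e d y by simp
  then have 2: "y \<otimes> e \<ominus> e \<otimes> y \<otimes> e = \<zero>"
    using e y by (simp add: d_def minus_eq l_distr l_minus)
  from 1 2 show ?thesis using e y by simp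
qed

text \<open>
  A special case of Jacobson's commutativity theorem with a direct proof. Fourth powers are
  idempotent, hence central; therefore it suffices to write \<open>x\<close> as an integer combination of fourth
  powers of elements \<open>x + c\<close> and of expressions that vanish. This is done separately for the multiples
  \<open>15 x\<close>, \<open>10 x\<close> and \<open>6 x\<close>, and \<open>x = 15 x + 10 x + 6 x - 30 x\<close>.
\<close>

theorem (in ring) quintic_commutative:
  assumes quint: "\<And>x. x \<in> carrier R \<Longrightarrow> x [^] (5::nat) = x"
  shows "cring R"
proof (rule cringI[OF abelian_group_axioms _ l_distr])
  show "comm_monoid R"
  proof (rule monoid.monoid_comm_monoidI[OF monoid_axioms])
    fix x y assume x: "x \<in> carrier R" and y: "y \<in> carrier R"
    have red: "z = \<zero>" if "z \<in> carrier R" "z \<otimes> z = \<zero>" for z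
    proof -
      have "z [^] (5::nat) = z \<otimes> z \<otimes> z \<otimes> z \<otimes> z" using that(1) by (simp add: eval_nat_numeral)
      then show ?thesis using that quint[of z] by simp
    qed
    let ?E = "int_poly_eval x"
    interpret E: ring_eval R ?E by (rule int_poly_eval[OF x])
    have E5: "?E (q ^ 5) = ?E q" for q by (simp add: E.power quint)
    note ids = E.quintic_identities[OF E5]
    define C where "C = {q. ?E q \<otimes> y = y \<otimes> ?E q}"
    have C_ker: "q \<in> C" if "?E q = \<zero>" for q using that y by (simp add: C_def)
    have C_diff: "p - q \<in> C" if "p \<in> C" "q \<in> C" for p q
      using that y by (simp add: C_def E.diff minus_eq l_distr r_distr l_minus r_minus)
    have C_add: "p + q \<in> C" if "p \<in> C" "q \<in> C" for p q
      using that y by (simp add: C_def E.add l_distr r_distr)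
    have C_nat: "of_nat k * q \<in> C" if "q \<in> C" for k q
      by (induction k) (use that in \<open>auto simp: algebra_simps C_add intro: C_ker E.zero\<close>)
    have C_num: "numeral k * q \<in> C" if "q \<in> C" for k q
      using C_nat[OF that, of "numeral k"] by simp
    have C4: "q ^ 4 \<in> C" for q
    proof -
      have "?E (q ^ 4) \<otimes> ?E (q ^ 4) = ?E (q ^ 5 * q ^ 3)"
        by (simp flip: E.mult power_add)
      also have "\<dots> = ?E (q ^ 4)"
        by (simp only: E.mult E5) (simp flip: E.mult add: eval_nat_numeral)
      finally show ?thesis
        using idempotent_central[OF red, of "?E (q ^ 4)" y] y by (simp add: C_def)
    qed
    \<comment> \<open>The first line equals \<open>15 q\<close>. Up to multiples of \<open>30 q\<close>, the second equals \<open>10 q\<close> and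
        the third \<open>6 q\<close>: the difference inside its brackets is \<open>48 q\<close>.\<close>
    have X: "q = 15 * q ^ 4 - 15 * ((q\<^sup>2)\<^sup>2 - q\<^sup>2) - 15 * (q\<^sup>2 - q)
        + 10 * ((q + 1) ^ 4 - (q - 1) ^ 4) - 8 * (10 * (q ^ 3 - q))
        + 2 * (((q + 2) ^ 4 - (q - 2) ^ 4) - 2 * ((q + 1) ^ 4 - (q - 1) ^ 4)) - 9 * (30 * q)"
      for q :: "int poly" by Groebner_Basis.algebra
    have "q \<in> C" for q
    proof -
      have ker15: "15 * (r\<^sup>2 - r) \<in> C" for r by (rule C_ker, rule ids)
      have ker10: "10 * (q ^ 3 - q) \<in> C" by (rule C_ker, rule ids)
      have ker30: "30 * q \<in> C" by (rule C_ker) (simp add: E.mult ids)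
      have "15 * q ^ 4 \<in> C" "10 * ((q + 1) ^ 4 - (q - 1) ^ 4) \<in> C"
        "2 * (((q + 2) ^ 4 - (q - 2) ^ 4) - 2 * ((q + 1) ^ 4 - (q - 1) ^ 4)) \<in> C"
        by (intro C_num C_diff C4)+
      then show ?thesis
        by (subst X[of q]) (intro C_diff C_add ker15 C_num[OF ker10] C_num[OF ker30])
    qed
    then show "x \<otimes> y = y \<otimes> x"
      using int_poly_eval_X[OF x] by (metis (mono_tags) C_def mem_Collect_eq)
  qed
qed

text \<open>
  The polynomial is \<open>(s - 2) (s - 1) s (s + 1) (s + 2)\<close>, and a sum of two numbers among \<open>-1, 0, 1\<close> is
  a root of it. Accordingly its value at \<open>a + b\<close> lies in the ideal generated by \<open>a^3 - a\<close> and
  \<open>b^3 - b\<close> in the polynomial ring in \<open>a\<close> and \<open>b\<close>. The element \<open>s\<close> lives in the domain of an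
  arbitrary evaluation so that the result applies to every polynomial in a given element.
\<close>

lemma (in ring) commuting_tripotents_sum:
  assumes e: "e \<in> carrier R" "e [^] (3::nat) = e" and f: "f \<in> carrier R" "f [^] (3::nat) = f"
    and ef: "f \<otimes> e = e \<otimes> f" and \<phi>: "ring_eval R \<phi>" and s: "\<phi> s = e \<oplus> f"
  shows "\<phi> (s ^ 5 - 5 * s ^ 3 + 4 * s) = \<zero>"
proof -
  interpret E: ring_eval R "int_poly_eval e" by (rule int_poly_eval[OF e(1)])
  interpret \<phi>: ring_eval R \<phi> by fact
  interpret Z: ring_eval R "\<lambda>k :: int. add_pow R k \<one>" by (rule ring_eval_int)
  have comm: "f \<otimes> int_poly_eval e p = int_poly_eval e p \<otimes> f" for p
    using Z.commute_adjoin[OF e(1) f(1) ef] e f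
    by (simp add: int_poly_eval_def add_pow_ldistr_int add_pow_rdistr_int)
  let ?\<psi> = "E.adjoin f"
  interpret EF: ring_eval R ?\<psi> by (rule E.ring_eval_adjoin[OF f(1) comm])
  define a b where "a = [:[:0, 1:] :: int poly:]" and "b = [:0, 1 :: int poly:]"
  have ab: "?\<psi> a = e" "?\<psi> b = f"
    using E.adjoin_const[OF f(1) comm] E.adjoin_X[OF f(1) comm] int_poly_eval_X[OF e(1)]
    by (simp_all add: a_def b_def)
  have 0: "?\<psi> (a ^ 3 - a) = \<zero>" "?\<psi> (b ^ 3 - b) = \<zero>"
    using e f by (simp_all add: EF.diff EF.power ab minus_eq r_neg)
  have id: "(a + b) ^ 5 - 5 * (a + b) ^ 3 + 4 * (a + b)
      = ((a + b)\<^sup>2 - 4 + 3 * a * b + 9 * b\<^sup>2) * (a ^ 3 - a)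
      + ((a + b)\<^sup>2 - 4 + 3 * a * b + 9 * a\<^sup>2) * (b ^ 3 - b)"
    for a b :: "int poly poly" by Groebner_Basis.algebra
  have "?\<psi> (u * (a ^ 3 - a) + v * (b ^ 3 - b)) = \<zero>" for u v
    by (simp only: EF.add EF.mult 0) simp
  then have "?\<psi> ((a + b) ^ 5 - 5 * (a + b) ^ 3 + 4 * (a + b)) = \<zero>"
    by (simp only: id[of a b])
  moreover have "?\<psi> ((a + b) ^ 5 - 5 * (a + b) ^ 3 + 4 * (a + b)) = \<phi> (s ^ 5 - 5 * s ^ 3 + 4 * s)"
    using EF.of_nat[of 5] EF.of_nat[of 4] \<phi>.of_nat[of 5] \<phi>.of_nat[of 4]
    by (simp add: EF.add EF.diff EF.mult EF.power \<phi>.add \<phi>.diff \<phi>.mult \<phi>.power ab s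
        e f r_distr)
  ultimately show ?thesis by simp
qed

text \<open>
  Write \<open>f q = q^5 - 5 q^3 + 4 q\<close>, which vanishes everywhere. From \<open>f 3 = 120\<close>, a divisor of \<open>30^3\<close>,
  reducedness gives \<open>30 = 0\<close>. As \<open>q^5 - q = f q + 5 (q^3 - q)\<close> and \<open>5 = 15 - 10\<close>, it remains to see
  that \<open>15 (q^3 - q)\<close> and \<open>10 (q^3 - q)\<close> vanish. Modulo 30 the values \<open>15 f q\<close> and \<open>10 f q\<close> are
  \<open>15 q^3 (q\<^sup>2 - 1)\<close> and \<open>10 q (q\<^sup>2 - 1)\<^sup>2\<close>, so the cubes of the two elements vanish.
\<close>

theorem (in ring) sum_of_commuting_tripotents_quintic:
  assumes red: "\<And>x. x \<in> carrier R \<Longrightarrow> x \<otimes> x = \<zero> \<Longrightarrow> x = \<zero>"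
    and sum: "\<And>x. x \<in> carrier R \<Longrightarrow>
      \<exists>e f. tripotent R e \<and> tripotent R f \<and> commuting R f e \<and> x = e \<oplus> f"
    and x: "x \<in> carrier R"
  shows "x [^] (5::nat) = x"
proof -
  let ?E = "int_poly_eval x" and ?X = "[:0, 1:] :: int poly"
  have E: "ring_eval R ?E" by (rule int_poly_eval[OF x])
  interpret E: ring_eval R ?E by (rule E)
  define f where "f q = q ^ 5 - 5 * q ^ 3 + 4 * q" for q :: "int poly"
  have f: "?E (f q) = \<zero>" for q
    using sum[of "?E q"] commuting_tripotents_sum[OF _ _ _ _ _ E]
    by (auto simp: tripotent_def commuting_def f_def)
  have rad: "?E q = \<zero>" if "?E (q ^ 3) = \<zero>" for q
  proof -
    have "?E ((q\<^sup>2)\<^sup>2) = \<zero>"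
      by (rule E.dvd_zero[OF that dvdI[of _ _ q]]) (simp add: eval_nat_numeral)
    then have "?E (q\<^sup>2) = \<zero>"
      using red[of "?E (q\<^sup>2)"] by (simp add: power2_eq_square E.mult)
    then show ?thesis using red[of "?E q"] by (simp add: power2_eq_square E.mult)
  qed
  have 30: "?E 30 = \<zero>"
  proof (rule rad)
    have "(30 :: int poly) ^ 3 = f 3 * 225" by (simp add: f_def)
    then show "?E (30 ^ 3) = \<zero>" by (simp only: E.mult f) simp
  qed
  have 15: "?E (15 * (q ^ 3 - q)) = \<zero>" for q
  proof (rule rad)
    have "(15 * (q ^ 3 - q)) ^ 3 = 15 * (q ^ 3 * (q\<^sup>2 - 1)) * (15 * (q\<^sup>2 - 1))\<^sup>2"
      by Groebner_Basis.algebra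
    moreover have "15 * (q ^ 3 * (q\<^sup>2 - 1)) = 15 * f q - 30 * (2 * q - 2 * q ^ 3)"
      unfolding f_def by Groebner_Basis.algebra
    ultimately show "?E ((15 * (q ^ 3 - q)) ^ 3) = \<zero>"
      by (simp only: E.mult E.diff f 30) (simp add: minus_eq)
  qed
  have 10: "?E (10 * (q ^ 3 - q)) = \<zero>" for q
  proof (rule rad)
    have "(10 * (q ^ 3 - q)) ^ 3 = 10 * (q * (q\<^sup>2 - 1)\<^sup>2) * (100 * q\<^sup>2 * (q\<^sup>2 - 1))"
      by Groebner_Basis.algebra
    moreover have "10 * (q * (q\<^sup>2 - 1)\<^sup>2) = 10 * f q - 30 * (q - q ^ 3)"
      unfolding f_def by Groebner_Basis.algebra
    ultimately show "?E ((10 * (q ^ 3 - q)) ^ 3) = \<zero>"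
      by (simp only: E.mult E.diff f 30) (simp add: minus_eq)
  qed
  have "q ^ 5 - q = f q + (15 * (q ^ 3 - q) - 10 * (q ^ 3 - q))" for q
    unfolding f_def by Groebner_Basis.algebra
  then have "?E (?X ^ 5 - ?X) = \<zero>"
    by (simp only: E.add E.diff[of "15 * _"] f 15 10) (simp add: minus_eq)
  then show ?thesis
    using x by (simp add: E.diff E.power int_poly_eval_X)
qed

section \<open>Non-unital homomorphisms and products\<close>

text \<open>
  Decompositions are transported along maps onto corners \<open>c S\<close> and along inclusions of diagonal
  blocks, which do not preserve the unit.
\<close>

locale rng_hom = R: ring R + S: ring S 
    for R :: "('a, 'm) ring_scheme" (structure) and S :: "('b, 'n) ring_scheme" (structure) +
  fixes \<phi> :: "'a \<Rightarrow> 'b"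
  assumes closed: "x \<in> carrier R \<Longrightarrow> \<phi> x \<in> carrier S"
    and add: "x \<in> carrier R \<Longrightarrow> y \<in> carrier R \<Longrightarrow> \<phi> (x \<oplus>\<^bsub>R\<^esub> y) = \<phi> x \<oplus>\<^bsub>S\<^esub> \<phi> y"
    and mult: "x \<in> carrier R \<Longrightarrow> y \<in> carrier R \<Longrightarrow> \<phi> (x \<otimes>\<^bsub>R\<^esub> y) = \<phi> x \<otimes>\<^bsub>S\<^esub> \<phi> y"
begin

lemma zero: "\<phi> \<zero>\<^bsub>R\<^esub> = \<zero>\<^bsub>S\<^esub>"
  using add[of "\<zero>\<^bsub>R\<^esub>" "\<zero>\<^bsub>R\<^esub>"] closed[of "\<zero>\<^bsub>R\<^esub>"] by simp

lemma split_tripotent: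
  assumes "split_tripotent R e"
  shows "split_tripotent S (\<phi> e)"
proof -
  obtain g h where "e \<in> carrier R" "g \<in> carrier R" "h \<in> carrier R" "g \<otimes>\<^bsub>R\<^esub> g = g" "h \<otimes>\<^bsub>R\<^esub> h = h"
      "g \<otimes>\<^bsub>R\<^esub> h = \<zero>\<^bsub>R\<^esub>" "h \<otimes>\<^bsub>R\<^esub> g = \<zero>\<^bsub>R\<^esub>" "e \<oplus>\<^bsub>R\<^esub> h = g"
    using assms unfolding split_tripotent_def by blast
  then show ?thesis
    unfolding split_tripotent_def
    by (intro conjI bexI[of _ "\<phi> g"] bexI[of _ "\<phi> h"]) (simp_all add: closed zero flip: add mult)
qed

lemma nilpotent:
  assumes "nilpotent R w"
  shows "nilpotent S (\<phi> w)"
proof -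
  obtain k :: nat where w: "w \<in> carrier R" and k: "w [^]\<^bsub>R\<^esub> k = \<zero>\<^bsub>R\<^esub>"
    using assms unfolding nilpotent_def by blast
  have "\<phi> w [^]\<^bsub>S\<^esub> Suc j = \<phi> (w [^]\<^bsub>R\<^esub> Suc j)" for j
    by (induction j) (use w in \<open>simp_all add: closed mult\<close>)
  moreover have "w [^]\<^bsub>R\<^esub> Suc k = \<zero>\<^bsub>R\<^esub>" using w k by simp
  ultimately show ?thesis
    using w closed zero unfolding nilpotent_def by metis
qed

lemma tripotent_nil_sum:
  assumes "tripotent_nil_sum R a"
  shows "tripotent_nil_sum S (\<phi> a)"
proof -
  obtain e f w where d: "split_tripotent R e" "split_tripotent R f" "nilpotent R w" "a = e \<oplus>\<^bsub>R\<^esub> f \<oplus>\<^bsub>R\<^esub> w"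
    using assms unfolding tripotent_nil_sum_def by blast
  then have "e \<in> carrier R" "f \<in> carrier R" "w \<in> carrier R"
    by (simp_all add: split_tripotent_def nilpotent_def)
  then have "\<phi> a = \<phi> e \<oplus>\<^bsub>S\<^esub> \<phi> f \<oplus>\<^bsub>S\<^esub> \<phi> w" by (simp add: d add)
  with d show ?thesis
    unfolding tripotent_nil_sum_def using split_tripotent nilpotent by blast
qed

end

lemma RDirProd_simps:
  "carrier (RDirProd R S) = carrier R \<times> carrier S"
  "(a, b) \<otimes>\<^bsub>RDirProd R S\<^esub> (a', b') = (a \<otimes>\<^bsub>R\<^esub> a', b \<otimes>\<^bsub>S\<^esub> b')"
  "(a, b) \<oplus>\<^bsub>RDirProd R S\<^esub> (a', b') = (a \<oplus>\<^bsub>R\<^esub> a', b \<oplus>\<^bsub>S\<^esub> b')"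
  "\<zero>\<^bsub>RDirProd R S\<^esub> = (\<zero>\<^bsub>R\<^esub>, \<zero>\<^bsub>S\<^esub>)" "\<one>\<^bsub>RDirProd R S\<^esub> = (\<one>\<^bsub>R\<^esub>, \<one>\<^bsub>S\<^esub>)"
  by (simp_all add: RDirProd_def DirProd_def monoid.defs)

lemma RDirProd_split_tripotent:
  assumes "split_tripotent R e" "split_tripotent S f"
  shows "split_tripotent (RDirProd R S) (e, f)"
proof -
  obtain g h where 1: "e \<in> carrier R" "g \<in> carrier R" "h \<in> carrier R" "g \<otimes>\<^bsub>R\<^esub> g = g" "h \<otimes>\<^bsub>R\<^esub> h = h"
      "g \<otimes>\<^bsub>R\<^esub> h = \<zero>\<^bsub>R\<^esub>" "h \<otimes>\<^bsub>R\<^esub> g = \<zero>\<^bsub>R\<^esub>" "e \<oplus>\<^bsub>R\<^esub> h = g"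
    using assms(1) unfolding split_tripotent_def by blast
  obtain g' h' where 2: "f \<in> carrier S" "g' \<in> carrier S" "h' \<in> carrier S" "g' \<otimes>\<^bsub>S\<^esub> g' = g'" "h' \<otimes>\<^bsub>S\<^esub> h' = h'"
      "g' \<otimes>\<^bsub>S\<^esub> h' = \<zero>\<^bsub>S\<^esub>" "h' \<otimes>\<^bsub>S\<^esub> g' = \<zero>\<^bsub>S\<^esub>" "f \<oplus>\<^bsub>S\<^esub> h' = g'"
    using assms(2) unfolding split_tripotent_def by blast
  show ?thesis
    unfolding split_tripotent_def using 1 2
    by (intro conjI bexI[of _ "(g, g')"] bexI[of _ "(h, h')"]) (simp_all add: RDirProd_simps)
qed

lemma RDirProd_nilpotent:
  assumes "ring R" "ring S" "nilpotent R v" "nilpotent S w"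
  shows "nilpotent (RDirProd R S) (v, w)"
proof -
  interpret R: ring R by fact
  interpret S: ring S by fact
  interpret P: ring "RDirProd R S" by (rule RDirProd_ring[OF assms(1,2)])
  obtain k l :: nat where v: "v \<in> carrier R" "v [^]\<^bsub>R\<^esub> k = \<zero>\<^bsub>R\<^esub>" and w: "w \<in> carrier S" "w [^]\<^bsub>S\<^esub> l = \<zero>\<^bsub>S\<^esub>"
    using assms unfolding nilpotent_def by blast
  have "(v, w) [^]\<^bsub>RDirProd R S\<^esub> j = (v [^]\<^bsub>R\<^esub> j, w [^]\<^bsub>S\<^esub> j)" for j :: nat
    by (induction j) (simp_all add: RDirProd_simps)
  moreover have "v [^]\<^bsub>R\<^esub> (k + l) = \<zero>\<^bsub>R\<^esub>" "w [^]\<^bsub>S\<^esub> (k + l) = \<zero>\<^bsub>S\<^esub>"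
    using v w R.nat_pow_mult[OF v(1), of k l, symmetric] S.nat_pow_mult[OF w(1), of k l, symmetric]
    by simp_all
  ultimately show ?thesis
    unfolding nilpotent_def using v w by (auto simp: RDirProd_simps intro!: exI[of _ "k + l"])
qed

lemma RDirProd_tripotent_nil_sum:
  assumes "ring R" "ring S" "tripotent_nil_sum R a" "tripotent_nil_sum S b"
  shows "tripotent_nil_sum (RDirProd R S) (a, b)"
proof -
  obtain e f w where 1: "split_tripotent R e" "split_tripotent R f" "nilpotent R w" "a = e \<oplus>\<^bsub>R\<^esub> f \<oplus>\<^bsub>R\<^esub> w"
    using assms(3) unfolding tripotent_nil_sum_def by blast
  obtain e' f' w' where 2: "split_tripotent S e'" "split_tripotent S f'" "nilpotent S w'" "b = e' \<oplus>\<^bsub>S\<^esub> f' \<oplus>\<^bsub>S\<^esub> w'"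
    using assms(4) unfolding tripotent_nil_sum_def by blast
  have "(a, b) = (e, e') \<oplus>\<^bsub>RDirProd R S\<^esub> (f, f') \<oplus>\<^bsub>RDirProd R S\<^esub> (w, w')"
    by (simp add: RDirProd_simps 1 2)
  then show ?thesis
    unfolding tripotent_nil_sum_def
    using RDirProd_split_tripotent[OF 1(1) 2(1)] RDirProd_split_tripotent[OF 1(2) 2(2)]
      RDirProd_nilpotent[OF assms(1,2) 1(3) 2(3)] by blast
qed

section \<open>Matrices over a field\<close>

lemma (in ring) split_tripotent_zero: "split_tripotent R \<zero>"
  unfolding split_tripotent_def by (auto intro!: bexI[of _ \<zero>])

abbreviation full_mat_ring :: "'k :: field itself \<Rightarrow> nat \<Rightarrow> 'k mat ring" where
  "full_mat_ring ty n \<equiv> ring_mat ty n ()"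

lemma similar_tripotent_nil_sum:
  fixes A :: "'k :: field mat"
  assumes "similar_mat A B" "A \<in> carrier_mat n n" "tripotent_nil_sum (full_mat_ring TYPE('k) n) B"
  shows "tripotent_nil_sum (full_mat_ring TYPE('k) n) A"
proof -
  let ?M = "full_mat_ring TYPE('k) n"
  obtain P Q where wit: "similar_mat_wit A B P Q"
    using assms(1) unfolding similar_mat_def by blast
  note w = similar_mat_witD2[OF assms(2) wit]
  have "P * (X * Y) * Q = P * X * Q * (P * Y * Q)"
    if X: "X \<in> carrier_mat n n" and Y: "Y \<in> carrier_mat n n" for X Y
  proof -
    note c = w(6,7) X Y assoc_mult_mat[where ?n\<^sub>1 = n and ?n\<^sub>2 = n and ?n\<^sub>3 = n and ?n\<^sub>4 = n]
      mult_carrier_mat[where nr = n and n = n and nc = n]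
    have "P * X * Q * (P * Y * Q) = P * (X * ((Q * P) * (Y * Q)))"
      by (simp add: c)
    also have "\<dots> = P * (X * Y) * Q"
      using left_mult_one_mat[OF c(6)[OF Y w(7)]] by (simp add: c w(2))
    finally show ?thesis by simp
  qed
  then interpret rng_hom ?M ?M "\<lambda>X. P * X * Q"
    using w(6,7) by (intro rng_hom.intro ring_mat rng_hom_axioms.intro)
      (auto simp: ring_mat_simps mult_add_distrib_mat[of _ n n] add_mult_distrib_mat[of _ n n])
  show ?thesis using tripotent_nil_sum[OF assms(3)] w(3) by simp
qed

lemma nilpotent_full_mat_ring_iff:
  fixes A :: "'k :: field mat"
  assumes "A \<in> carrier_mat n n"
  shows "nilpotent (full_mat_ring TYPE('k) n) A \<longleftrightarrow> (\<exists>k. A ^\<^sub>m k = 0\<^sub>m n n)"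
  using assms pow_mat_ring_pow[OF assms, where b = "()"]
  by (simp add: nilpotent_def ring_mat_simps)

text \<open>
  For large exponents only the block above the diagonal survives, and such a matrix has square zero.
\<close>

lemma four_block_triangular_nilpotent:
  fixes A :: "'k :: field mat"
  assumes A: "A \<in> carrier_mat n n" "A ^\<^sub>m k = 0\<^sub>m n n" and D: "D \<in> carrier_mat m m" "D ^\<^sub>m l = 0\<^sub>m m m"
    and B: "B \<in> carrier_mat n m"
  shows "nilpotent (full_mat_ring TYPE('k) (n + m)) (four_block_mat A B (0\<^sub>m m n) D)" (is "nilpotent ?M ?N")
proof -
  interpret M: ring ?M by (rule ring_mat)
  have N: "?N \<in> carrier_mat (n + m) (n + m)" using A D by simp
  have zero_pow: "X ^\<^sub>m (i + j) = 0\<^sub>m r r" if "X \<in> carrier_mat r r" "X ^\<^sub>m i = 0\<^sub>m r r"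
    for X :: "'k mat" and r i j
    by (induction j) (use that in simp_all)
  have "\<exists>C \<in> carrier_mat n m. ?N ^\<^sub>m j = four_block_mat (A ^\<^sub>m j) C (0\<^sub>m m n) (D ^\<^sub>m j)" for j
  proof (induction j)
    case 0
    show ?case
      using A D by (intro bexI[of _ "0\<^sub>m n m"]) simp_all
  next
    case (Suc j)
    then obtain C where C: "C \<in> carrier_mat n m"
      "?N ^\<^sub>m j = four_block_mat (A ^\<^sub>m j) C (0\<^sub>m m n) (D ^\<^sub>m j)" by blast
    have "?N ^\<^sub>m Suc j = four_block_mat (A ^\<^sub>m j * A + C * 0\<^sub>m m n) (A ^\<^sub>m j * B + C * D)
        (0\<^sub>m m n * A + D ^\<^sub>m j * 0\<^sub>m m n) (0\<^sub>m m n * B + D ^\<^sub>m j * D)"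
      using A D B C by (simp add: mult_four_block_mat[where ?nr1.0 = n and ?n1.0 = n and ?n2.0 = m and ?nr2.0 = m and ?nc1.0 = n and ?nc2.0 = m])
    also have "\<dots> = four_block_mat (A ^\<^sub>m Suc j) (A ^\<^sub>m j * B + C * D) (0\<^sub>m m n) (D ^\<^sub>m Suc j)"
      using A D B C mult_carrier_mat[OF pow_carrier_mat[OF A(1), of j] A(1)]
        mult_carrier_mat[OF pow_carrier_mat[OF D(1), of j] D(1)]
      by (intro cong_four_block_mat) simp_all
    finally show ?case
      using A D B C by (intro bexI[of _ "A ^\<^sub>m j * B + C * D"]) auto
  qed
  from this[of "k + l"] obtain C where C: "C \<in> carrier_mat n m"
    "?N ^\<^sub>m (k + l) = four_block_mat (0\<^sub>m n n) C (0\<^sub>m m n) (0\<^sub>m m m)"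
    using zero_pow[OF A, of l] zero_pow[OF D, of k] by (auto simp: add.commute)
  have "?N ^\<^sub>m (k + l) * ?N ^\<^sub>m (k + l) = four_block_mat (0\<^sub>m n n) (0\<^sub>m n m) (0\<^sub>m m n) (0\<^sub>m m m)"
    unfolding C(2) using C(1)
    by (subst mult_four_block_mat[where ?nr1.0 = n and ?n1.0 = n and ?n2.0 = m and ?nr2.0 = m and ?nc1.0 = n and ?nc2.0 = m]) simp_all
  then have "?N [^]\<^bsub>?M\<^esub> (k + l) \<otimes>\<^bsub>?M\<^esub> ?N [^]\<^bsub>?M\<^esub> (k + l) = \<zero>\<^bsub>?M\<^esub>"
    using pow_mat_ring_pow[OF N, where b = "()"] by (simp add: ring_mat_simps)
  then show ?thesis
    unfolding nilpotent_def using N M.nat_pow_mult[of ?N "k + l" "k + l"] by (auto simp: ring_mat_simps)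
qed

lemma four_block_diag_split_tripotent:
  fixes A :: "'k :: field mat"
  assumes "split_tripotent (full_mat_ring TYPE('k) n) A" "split_tripotent (full_mat_ring TYPE('k) m) D"
  shows "split_tripotent (full_mat_ring TYPE('k) (n + m)) (four_block_mat A (0\<^sub>m n m) (0\<^sub>m m n) D)"
proof -
  let ?diag = "\<lambda>(X, Y). four_block_mat X (0\<^sub>m n m) (0\<^sub>m m n) Y :: 'k mat"
  interpret rng_hom "RDirProd (full_mat_ring TYPE('k) n) (full_mat_ring TYPE('k) m)"
    "full_mat_ring TYPE('k) (n + m)" ?diag
  proof (intro rng_hom.intro rng_hom_axioms.intro RDirProd_ring ring_mat)
    fix p q assume "p \<in> carrier (RDirProd (full_mat_ring TYPE('k) n) (full_mat_ring TYPE('k) m))"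
      "q \<in> carrier (RDirProd (full_mat_ring TYPE('k) n) (full_mat_ring TYPE('k) m))"
    then obtain X Y X' Y' where pq: "p = (X, Y)" "q = (X', Y')"
      and c: "X \<in> carrier_mat n n" "Y \<in> carrier_mat m m" "X' \<in> carrier_mat n n" "Y' \<in> carrier_mat m m"
      by (auto simp: RDirProd_simps ring_mat_simps)
    show "?diag p \<in> carrier (full_mat_ring TYPE('k) (n + m))"
      using c by (simp add: pq ring_mat_simps)
    show "?diag (p \<oplus>\<^bsub>RDirProd (full_mat_ring TYPE('k) n) (full_mat_ring TYPE('k) m)\<^esub> q)
        = ?diag p \<oplus>\<^bsub>full_mat_ring TYPE('k) (n + m)\<^esub> ?diag q"
      using c unfolding pq RDirProd_simps ring_mat_simps prod.case
      by (subst add_four_block_mat[where ?nr1.0 = n and ?nr2.0 = m and ?nc1.0 = n and ?nc2.0 = m]) simp_all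
    show "?diag (p \<otimes>\<^bsub>RDirProd (full_mat_ring TYPE('k) n) (full_mat_ring TYPE('k) m)\<^esub> q)
        = ?diag p \<otimes>\<^bsub>full_mat_ring TYPE('k) (n + m)\<^esub> ?diag q"
      using c unfolding pq RDirProd_simps ring_mat_simps prod.case
      by (subst mult_four_block_mat[where ?nr1.0 = n and ?n1.0 = n and ?n2.0 = m and ?nr2.0 = m
            and ?nc1.0 = n and ?nc2.0 = m]) simp_all
  qed
  show ?thesis
    using split_tripotent[OF RDirProd_split_tripotent[OF assms]] by simp
qed

lemma four_block_triangular_tripotent_nil_sum:
  fixes A :: "'k :: field mat"
  assumes A: "A \<in> carrier_mat n n" "tripotent_nil_sum (full_mat_ring TYPE('k) n) A"
    and D: "D \<in> carrier_mat m m" "tripotent_nil_sum (full_mat_ring TYPE('k) m) D"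
    and B: "B \<in> carrier_mat n m"
  shows "tripotent_nil_sum (full_mat_ring TYPE('k) (n + m)) (four_block_mat A B (0\<^sub>m m n) D)"
proof -
  let ?diag = "\<lambda>A D. four_block_mat A (0\<^sub>m n m) (0\<^sub>m m n) D"
  obtain e f w where 1: "split_tripotent (full_mat_ring TYPE('k) n) e" "split_tripotent (full_mat_ring TYPE('k) n) f"
    "nilpotent (full_mat_ring TYPE('k) n) w" "A = e + f + w"
    using A(2) unfolding tripotent_nil_sum_def ring_mat_simps by blast
  obtain e' f' w' where 2: "split_tripotent (full_mat_ring TYPE('k) m) e'" "split_tripotent (full_mat_ring TYPE('k) m) f'"
    "nilpotent (full_mat_ring TYPE('k) m) w'" "D = e' + f' + w'"
    using D(2) unfolding tripotent_nil_sum_def ring_mat_simps by blast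
  have c: "e \<in> carrier_mat n n" "f \<in> carrier_mat n n" "w \<in> carrier_mat n n"
      "e' \<in> carrier_mat m m" "f' \<in> carrier_mat m m" "w' \<in> carrier_mat m m"
    using 1 2 by (simp_all add: split_tripotent_def nilpotent_def ring_mat_simps)
  have "nilpotent (full_mat_ring TYPE('k) (n + m)) (four_block_mat w B (0\<^sub>m m n) w')"
    using 1(3) 2(3) c B four_block_triangular_nilpotent[of w n _ w' m _ B]
    by (auto simp: nilpotent_full_mat_ring_iff)
  moreover have "four_block_mat A B (0\<^sub>m m n) D = ?diag e e' + ?diag f f' + four_block_mat w B (0\<^sub>m m n) w'"
    using c B unfolding 1(4) 2(4)
    by (subst add_four_block_mat[where ?nr1.0 = n and ?nr2.0 = m and ?nc1.0 = n and ?nc2.0 = m], simp_all)+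
  ultimately show ?thesis
    unfolding tripotent_nil_sum_def ring_mat_simps
    using four_block_diag_split_tripotent[OF 1(1) 2(1)] four_block_diag_split_tripotent[OF 1(2) 2(2)] by blast
qed

lemma strictly_lower_triangular_nilpotent:
  fixes N :: "'k :: field mat"
  assumes N: "N \<in> carrier_mat n n" and tri: "\<And>i j. i < n \<Longrightarrow> j < n \<Longrightarrow> i \<le> j \<Longrightarrow> N $$ (i, j) = 0"
  shows "nilpotent (full_mat_ring TYPE('k) n) N"
proof -
  have "\<forall>i<n. \<forall>j<n. i < j + k \<longrightarrow> (N ^\<^sub>m k) $$ (i, j) = 0" for k
  proof (induction k)
    case (Suc k)
    have "(N ^\<^sub>m Suc k) $$ (i, j) = 0" if ij: "i < n" "j < n" "i < j + Suc k" for i j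
    proof -
      have "(N ^\<^sub>m Suc k) $$ (i, j) = (\<Sum>l<n. (N ^\<^sub>m k) $$ (i, l) * N $$ (l, j))"
        using N ij by (simp add: scalar_prod_def lessThan_atLeast0)
      also have "\<dots> = 0"
      proof (intro sum.neutral ballI)
        fix l assume "l \<in> {..<n}"
        then show "(N ^\<^sub>m k) $$ (i, l) * N $$ (l, j) = 0"
          using Suc ij tri[of l j] by (cases "l \<le> j") auto
      qed
      finally show ?thesis .
    qed
    then show ?case by blast
  qed (use N in auto)
  from this[of n] have "N ^\<^sub>m n = 0\<^sub>m n n"
    using N by (intro eq_matI) auto
  then show ?thesis using nilpotent_full_mat_ring_iff[OF N] by blast
qed

text \<open>
  The square of such a matrix is \<open>c m\<close> times the matrix, so the matrix or its negative is idempotent.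
\<close>

lemma last_column_split_tripotent:
  fixes c :: "nat \<Rightarrow> 'k :: field"
  assumes s: "c m = 1 \<or> c m = -1"
  shows "split_tripotent (full_mat_ring TYPE('k) (Suc m)) (mat (Suc m) (Suc m) (\<lambda>(i, j). if j = m then c i else 0))"
    (is "split_tripotent ?M ?E")
proof -
  have E: "?E \<in> carrier_mat (Suc m) (Suc m)" by simp
  have sq: "?E * ?E = c m \<cdot>\<^sub>m ?E"
  proof (rule eq_matI)
    fix i j assume ij: "i < dim_row (c m \<cdot>\<^sub>m ?E)" "j < dim_col (c m \<cdot>\<^sub>m ?E)"
    then have "(?E * ?E) $$ (i, j) = (\<Sum>l<Suc m. (if l = m then c i else 0) * (if j = m then c l else 0))"
      by (simp add: scalar_prod_def lessThan_atLeast0 del: sum.lessThan_Suc sum.op_ivl_Suc)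
    also have "\<dots> = c i * (if j = m then c m else 0)"
      by (simp add: if_distrib[of "\<lambda>x. x * _"])
    also have "\<dots> = (c m \<cdot>\<^sub>m ?E) $$ (i, j)" using ij by simp
    finally show "(?E * ?E) $$ (i, j) = (c m \<cdot>\<^sub>m ?E) $$ (i, j)" .
  qed simp_all
  from s show ?thesis
  proof
    assume "c m = 1"
    with sq have "?E * ?E = ?E" by (auto intro!: eq_matI)
    then show ?thesis
      unfolding split_tripotent_def ring_mat_simps using E
      by (intro conjI bexI[of _ ?E] bexI[of _ "0\<^sub>m (Suc m) (Suc m)"]) simp_all
  next
    assume "c m = -1"
    with sq have "?E * ?E = - ?E" by (auto intro!: eq_matI)
    then have "(- ?E) * (- ?E) = - ?E" by simp
    moreover have "- 0\<^sub>m (Suc m) (Suc m) = (0\<^sub>m (Suc m) (Suc m) :: 'k mat)"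
      "?E + - ?E = 0\<^sub>m (Suc m) (Suc m)"
      by (auto intro!: eq_matI)
    ultimately show ?thesis
      unfolding split_tripotent_def ring_mat_simps using E
      by (intro conjI, simp) (rule bexI[of _ "0\<^sub>m (Suc m) (Suc m)"], rule bexI[of _ "- ?E"], simp_all)
  qed
qed

text \<open>
  The corner entry of the last column is \<open>s + t\<close>. The summand \<open>E\<close> takes \<open>s\<close> and the rest of the last
  column, \<open>F\<close> takes \<open>t\<close>, and the subdiagonal is nilpotent. The entries of the last column above the
  corner must go to \<open>E\<close>, because \<open>t\<close> may be zero and \<open>F\<close> would then be nilpotent instead of tripotent.
\<close>

lemma companion_tripotent_nil_sum:
  fixes A :: "'k :: field mat"
  assumes A: "A \<in> carrier_mat (Suc m) (Suc m)"
    and shift: "\<And>i j. i < Suc m \<Longrightarrow> j < m \<Longrightarrow> A $$ (i, j) = (if i = Suc j then 1 else 0)"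
    and trace: "A $$ (m, m) = s + t" "s = 1 \<or> s = -1" "t = 0 \<or> t = 1 \<or> t = -1"
  shows "tripotent_nil_sum (full_mat_ring TYPE('k) (Suc m)) A"
proof -
  let ?M = "full_mat_ring TYPE('k) (Suc m)"
  interpret M: ring ?M by (rule ring_mat)
  let ?col = "\<lambda>c. mat (Suc m) (Suc m) (\<lambda>(i, j). if j = m then c i else 0) :: 'k mat"
  define E where "E = ?col (\<lambda>i. if i = m then s else A $$ (i, m))"
  define F where "F = ?col (\<lambda>i. if i = m then t else 0)"
  define N where "N = mat (Suc m) (Suc m) (\<lambda>(i, j). if i = Suc j then 1 else 0 :: 'k)"
  have "split_tripotent ?M E"
    unfolding E_def by (rule last_column_split_tripotent) (use trace in simp)
  moreover have "split_tripotent ?M F"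
  proof (cases "t = 0")
    case True
    then have "F = \<zero>\<^bsub>?M\<^esub>" by (intro eq_matI) (auto simp: F_def ring_mat_simps)
    then show ?thesis using M.split_tripotent_zero by simp
  next
    case False
    then show ?thesis
      unfolding F_def by (intro last_column_split_tripotent) (use trace in simp)
  qed
  moreover have "nilpotent ?M N"
    by (rule strictly_lower_triangular_nilpotent) (auto simp: N_def)
  moreover have "A = E + F + N"
  proof (rule eq_matI)
    fix i j assume "i < dim_row (E + F + N)" "j < dim_col (E + F + N)"
    then have "i < Suc m" "j < Suc m" by (simp_all add: N_def)
    then show "A $$ (i, j) = (E + F + N) $$ (i, j)"
      using shift[of i j] trace(1) by (auto simp: E_def F_def N_def less_Suc_eq)
  qed (use A in \<open>simp_all add: N_def\<close>)
  ultimately show ?thesis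
    unfolding tripotent_nil_sum_def ring_mat_simps by blast
qed

lemma mult_mat_unit_vec:
  fixes A :: "'k :: semiring_1 mat"
  assumes "A \<in> carrier_mat m n" "j < n"
  shows "A *\<^sub>v unit_vec n j = col A j"
  using assms by (intro eq_vecI) (auto simp: scalar_prod_right_unit)

text \<open>
  Similarity to a block upper triangular matrix with two nonempty diagonal blocks, of sizes \<open>r\<close> and
  \<open>n - r\<close>.
\<close>

definition block_reducible :: "nat \<Rightarrow> 'k :: field mat \<Rightarrow> bool" where
  "block_reducible n A \<longleftrightarrow> (\<exists>B r. similar_mat A B \<and> 0 < r \<and> r < n \<and>
     (\<forall>i j. r \<le> i \<longrightarrow> i < n \<longrightarrow> j < r \<longrightarrow> B $$ (i, j) = 0))"

text \<open>
  A change of basis that keeps the basis vectors up to \<open>k\<close> and has \<open>x\<close> as the next one. It is the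
  rank one modification \<open>P = 1 + u f\<close> of the identity with column \<open>u = x - e_(k + 1)\<close> and row \<open>f\<close>.
  The row has to vanish up to \<open>k\<close>, to be \<open>1\<close> at \<open>k + 1\<close>, and to give \<open>\<mu> = 1 + f u\<close> a nonzero value;
  then \<open>1 - u f / \<mu>\<close> is the inverse.
\<close>

lemma invertible_replacing_basis_vector:
  fixes x :: "nat \<Rightarrow> 'k :: field"
  assumes k: "Suc k < n" and i: "k < i" "i < n" "x i \<noteq> 0"
  obtains P Q where "P \<in> carrier_mat n n" "Q \<in> carrier_mat n n" "P * Q = 1\<^sub>m n" "Q * P = 1\<^sub>m n"
    "\<And>j. j \<le> k \<Longrightarrow> P *\<^sub>v unit_vec n j = unit_vec n j" "P *\<^sub>v unit_vec n (Suc k) = vec n x"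
proof -
  define u where "u l = x l - (if l = Suc k then 1 else 0)" for l
  \<comment> \<open>The row \<open>e_(k + 1)\<close> gives \<open>\<mu> = x (k + 1)\<close>; if this is zero, adding \<open>e_i\<close> gives \<open>\<mu> = x i\<close>.\<close>
  define g where "g = (if x (Suc k) = 0 then 1 else 0 :: 'k)"
  define f where "f l = (if l = Suc k then 1 else 0) + (if l = i then g else 0)" for l
  define \<mu> where "\<mu> = 1 + (\<Sum>l<n. f l * u l)"
  define P where "P = mat n n (\<lambda>(a, b). (if a = b then 1 else 0) + u a * f b)"
  define Q where "Q = mat n n (\<lambda>(a, b). (if a = b then 1 else 0) - u a * f b / \<mu>)"
  have "(\<Sum>l<n. f l * u l) = (\<Sum>l<n. (if l = Suc k then u l else 0) + (if l = i then g * u l else 0))"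
    by (rule sum.cong) (auto simp: f_def algebra_simps)
  also have "\<dots> = u (Suc k) + g * u i"
    using k i by (simp add: sum.distrib)
  finally have \<mu>: "\<mu> \<noteq> 0"
    using i by (cases "i = Suc k") (auto simp: \<mu>_def u_def g_def)
  have carr: "P \<in> carrier_mat n n" "Q \<in> carrier_mat n n" by (simp_all add: P_def Q_def)
  have PQ: "P * Q = 1\<^sub>m n"
  proof (rule eq_matI)
    fix a b assume "a < dim_row (1\<^sub>m n)" "b < dim_col (1\<^sub>m n)"
    then have ab: "a < n" "b < n" by simp_all
    have "(P * Q) $$ (a, b) = (\<Sum>l<n. ((if a = l then 1 else 0) + u a * f l) * ((if l = b then 1 else 0) - u l * f b / \<mu>))"
      using ab by (simp add: P_def Q_def scalar_prod_def lessThan_atLeast0)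
    also have "\<dots> = (\<Sum>l<n. (if l = a then (if a = b then 1 else 0) - u a * f b / \<mu> else 0)
        + (if l = b then u a * f b else 0) - (u a * f b / \<mu>) * (f l * u l))"
      by (rule sum.cong) (auto simp: algebra_simps)
    also have "\<dots> = (if a = b then 1 else 0) - u a * f b / \<mu> + u a * f b - (u a * f b / \<mu>) * (\<mu> - 1)"
      using ab sum_distrib_left[of "u a * f b / \<mu>" "\<lambda>l. f l * u l" "{..<n}", symmetric]
      by (simp only: sum.distrib sum_subtractf) (simp add: \<mu>_def)
    also have "\<dots> = (if a = b then 1 else 0)"
      using \<mu> by (simp add: field_simps)
    finally show "(P * Q) $$ (a, b) = 1\<^sub>m n $$ (a, b)" using ab by simp
  qed (simp_all add: P_def Q_def)
  have col: "P *\<^sub>v unit_vec n j = vec n (\<lambda>a. (if a = j then 1 else 0) + u a * f j)" if "j < n" for j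
    using mult_mat_unit_vec[OF carr(1) that] that by (auto simp: P_def intro!: eq_vecI)
  show ?thesis
  proof (rule that[OF carr PQ mat_mult_left_right_inverse[OF carr PQ]])
    show "P *\<^sub>v unit_vec n j = unit_vec n j" if "j \<le> k" for j
      using col[of j] that k i by (auto simp: f_def unit_vec_def)
    show "P *\<^sub>v unit_vec n (Suc k) = vec n x"
    proof -
      have uf: "u a * f (Suc k) = u a" for a
        using i by (auto simp: f_def g_def u_def)
      show ?thesis unfolding col[OF k] uf by (auto simp: u_def intro!: eq_vecI)
    qed
  qed
qed

text \<open>
  Builds a cyclic basis one vector at a time. If the image of the vector \<open>k\<close> is in the span of the
  vectors up to \<open>k\<close>, that span is invariant and the matrix is reducible. Otherwise the image has a
  nonzero coordinate beyond \<open>k\<close> and can be taken as the next basis vector.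
\<close>

lemma reducible_or_shift:
  fixes A :: "'k :: field mat"
  assumes A: "A \<in> carrier_mat n n" and "k < n"
  shows "block_reducible n A \<or>
    (\<exists>B \<in> carrier_mat n n. similar_mat A B \<and> (\<forall>j<k. B *\<^sub>v unit_vec n j = unit_vec n (Suc j)))"
  using \<open>k < n\<close>
proof (induction k)
  case 0
  then show ?case using A similar_mat_refl[OF A] by auto
next
  case (Suc k)
  show ?case
  proof (cases "block_reducible n A")
    case False
    then obtain B where B: "B \<in> carrier_mat n n" "similar_mat A B"
      and shift: "\<And>j. j < k \<Longrightarrow> B *\<^sub>v unit_vec n j = unit_vec n (Suc j)"
      using Suc by auto
    have entry: "B $$ (a, b) = (B *\<^sub>v unit_vec n b) $ a" if "a < n" "b < n" for a b
      using mult_mat_unit_vec[OF B(1) that(2)] B(1) that by simp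
    have "\<exists>i>k. i < n \<and> B $$ (i, k) \<noteq> 0"
    proof (rule ccontr)
      assume "\<not> ?thesis"
      then have "B $$ (a, b) = 0" if "Suc k \<le> a" "a < n" "b < Suc k" for a b
        using that entry[of a b] shift[of b] Suc.prems by (cases "b = k") auto
      then have "block_reducible n A"
        using B Suc.prems unfolding block_reducible_def by blast
      with False show False by simp
    qed
    then obtain i where i: "k < i" "i < n" "B $$ (i, k) \<noteq> 0" by blast
    obtain P Q where PQ: "P \<in> carrier_mat n n" "Q \<in> carrier_mat n n" "P * Q = 1\<^sub>m n" "Q * P = 1\<^sub>m n"
      and fixed: "\<And>j. j \<le> k \<Longrightarrow> P *\<^sub>v unit_vec n j = unit_vec n j"
      and new: "P *\<^sub>v unit_vec n (Suc k) = vec n (\<lambda>a. B $$ (a, k))"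
      using invertible_replacing_basis_vector[OF Suc.prems i(1,2), of "\<lambda>a. B $$ (a, k)"] i(3) by blast
    have colk: "vec n (\<lambda>a. B $$ (a, k)) = B *\<^sub>v unit_vec n k"
      using entry[of _ k] Suc.prems B(1) by (intro eq_vecI) auto
    have cancel: "Q *\<^sub>v (P *\<^sub>v v) = v" if "v \<in> carrier_vec n" for v
      using PQ that assoc_mult_mat_vec[OF PQ(2,1) that] by simp
    define C where "C = Q * B * P"
    have C: "C \<in> carrier_mat n n" using PQ B by (simp add: C_def)
    have "similar_mat B C"
    proof (rule similar_matI[of _ _ P Q n])
      have "P * C * Q = P * Q * (B * (P * Q))"
        using PQ(1,2) B(1) mult_carrier_mat[where nr = n and n = n and nc = n]
        by (simp add: C_def assoc_mult_mat[of _ n n _ n _ n])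
      then show "B = P * C * Q" using PQ B(1) by simp
    qed (use PQ B C in auto)
    then have "similar_mat A C" using B(2) similar_mat_trans by blast
    moreover have "C *\<^sub>v unit_vec n j = unit_vec n (Suc j)" if "j < Suc k" for j
    proof -
      have "C *\<^sub>v unit_vec n j = Q *\<^sub>v (B *\<^sub>v (P *\<^sub>v unit_vec n j))"
        using PQ(1,2) B(1) by (simp add: C_def assoc_mult_mat_vec[of _ n n _ n])
      also have "P *\<^sub>v unit_vec n j = unit_vec n j" using fixed that by simp
      also have "B *\<^sub>v unit_vec n j = P *\<^sub>v unit_vec n (Suc j)"
      proof (cases "j = k")
        case True
        then show ?thesis using new colk by simp
      next
        case False
        then show ?thesis using that shift[of j] fixed[of "Suc j"] by simp
      qed
      finally show ?thesis using cancel by simp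
    qed
    ultimately show ?thesis using C by blast
  qed simp
qed

text \<open>
  Induction on the size: a matrix that is not similar to a block triangular one is similar to a
  companion matrix.
\<close>

theorem matrix_tripotent_nil_sum:
  fixes A :: "'k :: field mat"
  assumes signs: "\<And>x :: 'k. \<exists>s t. x = s + t \<and> (s = 1 \<or> s = -1) \<and> (t = 0 \<or> t = 1 \<or> t = -1)"
    and A: "A \<in> carrier_mat n n"
  shows "tripotent_nil_sum (full_mat_ring TYPE('k) n) A"
  using A
proof (induction n arbitrary: A rule: less_induct)
  case (less n)
  show ?case
  proof (cases n)
    case 0
    interpret M: ring "full_mat_ring TYPE('k) n" by (rule ring_mat)
    have "nilpotent (full_mat_ring TYPE('k) n) A"
      using less.prems 0 by (auto simp: nilpotent_full_mat_ring_iff intro!: exI[of _ 0] eq_matI)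
    moreover have "A = 0\<^sub>m n n + 0\<^sub>m n n + A" using less.prems by simp
    ultimately show ?thesis
      unfolding tripotent_nil_sum_def using M.split_tripotent_zero unfolding ring_mat_simps by blast
  next
    case (Suc m)
    show ?thesis
    proof (cases "block_reducible n A")
      case True
      then obtain B r where B: "similar_mat A B" and r: "0 < r" "r < n"
        and zero: "\<And>i j. r \<le> i \<Longrightarrow> i < n \<Longrightarrow> j < r \<Longrightarrow> B $$ (i, j) = 0"
        unfolding block_reducible_def by blast
      have Bc: "B \<in> carrier_mat n n"
        using B less.prems by (auto dest!: similar_matD)
      obtain B1 B2 B3 B4 where split: "split_block B r r = (B1, B2, B3, B4)"
        by (metis prod_cases4)
      have n: "n = r + (n - r)" using r by simp
      note sb = split_block[OF split, of "n - r" "n - r"]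
      have c: "B1 \<in> carrier_mat r r" "B2 \<in> carrier_mat r (n - r)" "B3 \<in> carrier_mat (n - r) r"
        "B4 \<in> carrier_mat (n - r) (n - r)" "B = four_block_mat B1 B2 B3 B4"
        using sb Bc r by auto
      have "B3 = 0\<^sub>m (n - r) r"
        using split Bc zero r by (intro eq_matI) (auto simp: split_block_def Let_def)
      then have "tripotent_nil_sum (full_mat_ring TYPE('k) (r + (n - r))) B"
        using four_block_triangular_tripotent_nil_sum[OF c(1) _ c(4) _ c(2)] less.IH c r by auto
      then have "tripotent_nil_sum (full_mat_ring TYPE('k) n) B" using n by simp
      then show ?thesis by (rule similar_tripotent_nil_sum[OF B less.prems])
    next
      case False
      then obtain B where B: "B \<in> carrier_mat n n" "similar_mat A B"
        and shift: "\<And>j. j < m \<Longrightarrow> B *\<^sub>v unit_vec n j = unit_vec n (Suc j)"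
        using reducible_or_shift[OF less.prems, of m] Suc by auto
      have "B $$ (i, j) = (if i = Suc j then 1 else 0)" if "i < Suc m" "j < m" for i j
      proof -
        have "B $$ (i, j) = (B *\<^sub>v unit_vec n j) $ i"
          using mult_mat_unit_vec[OF B(1), of j] B(1) that Suc by simp
        then show ?thesis using shift[OF that(2)] that Suc by simp
      qed
      then have "tripotent_nil_sum (full_mat_ring TYPE('k) n) B"
        using companion_tripotent_nil_sum[of B m] signs[of "B $$ (m, m)"] B Suc by blast
      then show ?thesis by (rule similar_tripotent_nil_sum[OF B(2) less.prems])
    qed
  qed
qed

section \<open>Separation by idempotents\<close>

definition ring_idempotent :: "('a, 'b) ring_scheme \<Rightarrow> 'a \<Rightarrow> bool" where
  "ring_idempotent R c \<longleftrightarrow> c \<in> carrier R \<and> c \<otimes>\<^bsub>R\<^esub> c = c"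

lemma (in cring) idempotent_mult:
  assumes "ring_idempotent R c" "ring_idempotent R d"
  shows "ring_idempotent R (c \<otimes> d)" "c \<otimes> (c \<otimes> d) = c \<otimes> d"
proof -
  have c: "c \<in> carrier R" "c \<otimes> c = c" and d: "d \<in> carrier R" "d \<otimes> d = d"
    using assms by (simp_all add: ring_idempotent_def)
  have "c \<otimes> d \<otimes> (c \<otimes> d) = (c \<otimes> c) \<otimes> (d \<otimes> d)"
    using c(1) d(1) by (simp add: m_ac)
  then show "ring_idempotent R (c \<otimes> d)" using c d by (simp add: ring_idempotent_def)
  show "c \<otimes> (c \<otimes> d) = c \<otimes> d" using c d by (simp flip: m_assoc)
qed

locale quintic_ring = cring +
  assumes quint: "x \<in> carrier R \<Longrightarrow> x [^] (5::nat) = x"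
begin

text \<open>
  The statements about idempotents below have the form of an induction: a property \<open>Q\<close> that is additive
  over orthogonal idempotents holds for \<open>c\<close> once it holds for sufficiently small idempotents below
  \<open>c\<close>. Here \<open>c\<close> is cut along the idempotent \<open>u = (x - k)^4\<close>. On the part \<open>c (1 - u)\<close> the element
  \<open>x\<close> has the value \<open>k\<close>, because \<open>(1 - u) (x - k) = 0\<close>; the other part is left for another value.
\<close>

lemma separate_value:
  assumes add: "\<And>c d. ring_idempotent R c \<Longrightarrow> ring_idempotent R d \<Longrightarrow> c \<otimes> d = \<zero> \<Longrightarrow> Q c \<Longrightarrow> Q d \<Longrightarrow> Q (c \<oplus> d)"
    and x: "x \<in> carrier R" and c: "ring_idempotent R c"
    and scalar: "\<And>d k. ring_idempotent R d \<Longrightarrow> c \<otimes> d = d \<Longrightarrow> d \<otimes> x = add_pow R (k :: int) d \<Longrightarrow> Q d"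
    and rest: "Q (c \<otimes> (x \<ominus> add_pow R (k :: int) \<one>) [^] (4::nat))"
  shows "Q c"
proof -
  define y where "y = x \<ominus> add_pow R k \<one>"
  define u where "u = y [^] (4::nat)"
  define v where "v = \<one> \<ominus> u"
  have cc: "c \<in> carrier R" using c by (simp add: ring_idempotent_def)
  have y: "y \<in> carrier R" using x by (simp add: y_def)
  then have u: "u \<in> carrier R" and v: "v \<in> carrier R" by (simp_all add: u_def v_def)
  have uy: "u \<otimes> y = y"
    using quint[OF y] y by (simp add: u_def eval_nat_numeral)
  have "u \<otimes> u = y [^] (5 + 3 :: nat)"
    using y by (simp add: u_def nat_pow_mult)
  also have "\<dots> = u"
    using y quint[OF y] by (simp add: u_def eval_nat_numeral m_ac flip: nat_pow_mult)
  finally have uu: "u \<otimes> u = u" .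
  have uv: "u \<oplus> v = \<one>" "u \<otimes> v = \<zero>" "v \<otimes> v = v" "v \<otimes> y = \<zero>"
    using u y uu uy
    by (simp_all add: v_def minus_eq l_distr r_distr l_minus r_minus r_neg a_lcomm[of u \<one>])
  have iu: "ring_idempotent R u" and iv: "ring_idempotent R v" using u v uu uv by (simp_all add: ring_idempotent_def)
  have "c \<otimes> v \<otimes> x = c \<otimes> v \<otimes> y \<oplus> c \<otimes> v \<otimes> add_pow R k \<one>"
    using cc v x by (simp add: y_def minus_eq r_distr r_minus a_assoc l_neg)
  also have "\<dots> = add_pow R k (c \<otimes> v)"
    using cc v y uv(4) by (simp add: m_assoc add_pow_rdistr_int)
  finally have "Q (c \<otimes> v)"
    using scalar[OF idempotent_mult[OF c iv]] by simp
  moreover have "Q (c \<otimes> u)" using rest by (simp add: u_def y_def)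
  moreover have "c \<otimes> u \<otimes> (c \<otimes> v) = c \<otimes> c \<otimes> (u \<otimes> v)"
    using cc u v by (simp add: m_ac)
  then have "c \<otimes> u \<otimes> (c \<otimes> v) = \<zero>" using cc uv by simp
  ultimately have "Q (c \<otimes> u \<oplus> c \<otimes> v)"
    using add[OF idempotent_mult(1)[OF c iu] idempotent_mult(1)[OF c iv]] by simp
  moreover have "c \<otimes> u \<oplus> c \<otimes> v = c"
    using cc u v uv(1) by (simp flip: r_distr)
  ultimately show ?thesis by simp
qed

text \<open>
  After the values \<open>0, ..., 4\<close> have been split off, the remaining idempotent is \<open>c\<close> times the fourth
  power of \<open>x (x - 1) (x - 2) (x - 3) (x - 4) = 0\<close>.
\<close>

lemma separate_values:
  assumes add: "\<And>c d. ring_idempotent R c \<Longrightarrow> ring_idempotent R d \<Longrightarrow> c \<otimes> d = \<zero> \<Longrightarrow> Q c \<Longrightarrow> Q d \<Longrightarrow> Q (c \<oplus> d)"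
    and x: "x \<in> carrier R" and c: "ring_idempotent R c"
    and scalar: "\<And>d k. ring_idempotent R d \<Longrightarrow> c \<otimes> d = d \<Longrightarrow> d \<otimes> x = add_pow R (k :: int) d \<Longrightarrow> Q d"
  shows "Q c"
proof -
  let ?E = "int_poly_eval x"
  interpret E: ring_eval R ?E by (rule int_poly_eval[OF x])
  have E5: "?E (q ^ 5) = ?E q" for q by (simp add: E.power quint)
  have cc: "c \<in> carrier R" using c by (simp add: ring_idempotent_def)
  have sub: "?E ([:0, 1:] - [:k:]) = x \<ominus> add_pow R k \<one>" for k
    by (simp only: E.diff int_poly_eval_X[OF x] int_poly_eval_const[OF x])
  have idem: "ring_idempotent R (?E (q ^ 4))" for q
  proof -
    have "?E (q ^ 4) \<otimes> ?E (q ^ 4) = ?E (q ^ 5 * q ^ 3)" by (simp flip: E.mult power_add)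
    also have "\<dots> = ?E (q ^ 4)"
      by (simp only: E.mult E5) (simp flip: E.mult add: eval_nat_numeral)
    finally show ?thesis by (simp add: ring_idempotent_def)
  qed
  have step: "Q (c \<otimes> ?E (q ^ 4))" if "Q (c \<otimes> ?E ((q * ([:0, 1:] - [:k:])) ^ 4))" for q k
  proof (rule separate_value[where Q = Q, OF add x idempotent_mult(1)[OF c idem], where k = k])
    fix d l assume d: "ring_idempotent R d" "c \<otimes> ?E (q ^ 4) \<otimes> d = d" "d \<otimes> x = add_pow R (l :: int) d"
    then have "c \<otimes> d = c \<otimes> c \<otimes> ?E (q ^ 4) \<otimes> d"
      using cc by (simp add: m_assoc ring_idempotent_def)
    also have "\<dots> = d" using c d by (simp add: ring_idempotent_def)
    finally show "Q d" using scalar d by blast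
  next
    show "Q (c \<otimes> ?E (q ^ 4) \<otimes> (x \<ominus> add_pow R k \<one>) [^] (4::nat))"
    proof -
      have "c \<otimes> ?E (q ^ 4) \<otimes> (x \<ominus> add_pow R k \<one>) [^] (4::nat)
          = c \<otimes> (?E (q ^ 4) \<otimes> ?E ([:0, 1:] - [:k:]) [^] (4::nat))"
        unfolding sub using cc x by (simp add: m_assoc)
      then show ?thesis using that by (simp only: power_mult_distrib E.mult E.power)
    qed
  qed
  let ?X = "[:0, 1:] :: int poly"
  have "?E (1 * (?X - [:0:]) * (?X - [:1:]) * (?X - [:2:]) * (?X - [:3:]) * (?X - [:4:])) = \<zero>"
    using E.quintic_identities(4)[OF E5, of ?X] by (simp only: mult_1_left) (simp add: numeral_poly one_pCons del: mult_pCons_left mult_pCons_right)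
  then have "?E ((1 * (?X - [:0:]) * (?X - [:1:]) * (?X - [:2:]) * (?X - [:3:]) * (?X - [:4:])) ^ 4) = \<zero>"
    by (simp only: E.power) (simp add: nat_pow_zero)
  moreover have "Q \<zero>"
    using scalar[of \<zero> 0] cc x by (simp add: ring_idempotent_def)
  ultimately have "Q (c \<otimes> ?E ((1 * (?X - [:0:]) * (?X - [:1:]) * (?X - [:2:]) * (?X - [:3:]) * (?X - [:4:])) ^ 4))"
    using cc by simp
  then have "Q (c \<otimes> ?E (1 ^ 4))" 
    by (rule step[of _ 0, OF step[of _ 1, OF step[of _ 2, OF step[of _ 3, OF step[of _ 4]]]]])
  then show ?thesis using cc by (simp add: E.one)
qed

lemma separate_finite:
  assumes add: "\<And>c d. ring_idempotent R c \<Longrightarrow> ring_idempotent R d \<Longrightarrow> c \<otimes> d = \<zero> \<Longrightarrow> Q c \<Longrightarrow> Q d \<Longrightarrow> Q (c \<oplus> d)"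
    and X: "finite X" "X \<subseteq> carrier R" and c: "ring_idempotent R c"
    and scalar: "\<And>d. ring_idempotent R d \<Longrightarrow> c \<otimes> d = d \<Longrightarrow> (\<forall>x\<in>X. \<exists>k::int. d \<otimes> x = add_pow R k d) \<Longrightarrow> Q d"
  shows "Q c"
  using X scalar
proof (induction X rule: finite_induct)
  case empty
  then show ?case using c by (simp add: ring_idempotent_def)
next
  case (insert x X)
  show ?case
  proof (rule insert.IH)
    fix d assume d: "ring_idempotent R d" "c \<otimes> d = d" "\<forall>x\<in>X. \<exists>k::int. d \<otimes> x = add_pow R k d"
    show "Q d"
    proof (rule separate_values[where Q = Q, OF add, of x d])
      fix e k assume e: "ring_idempotent R e" "d \<otimes> e = e" "e \<otimes> x = add_pow R (k :: int) e"
      have cc: "c \<in> carrier R" "d \<in> carrier R" "e \<in> carrier R"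
        using c d e by (simp_all add: ring_idempotent_def)
      have "c \<otimes> e = c \<otimes> d \<otimes> e" using cc e(2) by (simp add: m_assoc)
      then have "c \<otimes> e = e" using d e by simp
      moreover have "\<exists>k::int. e \<otimes> y = add_pow R k e" if y: "y \<in> X" for y
      proof -
        obtain l :: int where "d \<otimes> y = add_pow R l d" using d y by blast
        moreover have "d \<otimes> e \<otimes> y = e \<otimes> (d \<otimes> y)"
          using cc y insert.prems(1) by (simp add: m_ac subset_iff)
        ultimately have "d \<otimes> e \<otimes> y = add_pow R l (d \<otimes> e)"
          using cc by (simp add: add_pow_rdistr_int m_comm)
        then show ?thesis unfolding e(2) by blast
      qed
      ultimately show "Q e" using insert.prems(2) e by blast
    qed (use insert.prems d in auto)
  qed (use insert.prems in auto)
qed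

text \<open>
  As \<open>30 = 0\<close>, the elements 15, 10 and 6 are orthogonal idempotents with sum \<open>31 = 1\<close>, killed by 2,
  3 and 5 respectively.
\<close>

lemma separate_characteristic:
  assumes add: "\<And>c d. ring_idempotent R c \<Longrightarrow> ring_idempotent R d \<Longrightarrow> c \<otimes> d = \<zero> \<Longrightarrow> Q c \<Longrightarrow> Q d \<Longrightarrow> Q (c \<oplus> d)"
    and char: "\<And>c p. ring_idempotent R c \<Longrightarrow> p \<in> {2, 3, 5} \<Longrightarrow> add_pow R (p :: int) c = \<zero> \<Longrightarrow> Q c"
  shows "Q \<one>"
proof -
  let ?z = "\<lambda>k :: int. add_pow R k \<one>"
  interpret Z: ring_eval R ?z by (rule ring_eval_int)
  have 30: "?z 30 = \<zero>"
    by (rule Z.quintic_identities) (simp add: Z.power quint)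
  have mod: "?z (k + 30 * l) = ?z k" for k l
    by (simp only: Z.add Z.mult 30) simp
  have mult: "add_pow R k (?z l) = ?z (l * k)" for k l
    by (simp add: add.int_pow_pow)
  have i: "ring_idempotent R (?z 15)" "ring_idempotent R (?z 10)" "ring_idempotent R (?z 6)" "ring_idempotent R (?z 16)"
    using mod[of 15 7] mod[of 10 3] mod[of 6 1] mod[of 16 8] unfolding ring_idempotent_def Z.mult[symmetric] by simp_all
  have "Q (?z 15)" using char[OF i(1), of 2] mult[of 2 15] 30 by simp
  moreover have "Q (?z 16)"
  proof -
    have "Q (?z 10)" using char[OF i(2), of 3] mult[of 3 10] 30 by simp
    moreover have "Q (?z 6)" using char[OF i(3), of 5] mult[of 5 6] 30 by simp
    ultimately show ?thesis
      using add[OF i(2) i(3)] mod[of 0 2] Z.mult[of 10 6] Z.add[of 10 6] Z.zero by simp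
  qed
  ultimately show ?thesis
    using add[OF i(1) i(4)] mod[of 0 8] mod[of 1 1] Z.mult[of 15 16] Z.add[of 15 16] Z.zero Z.one by simp
qed

end

section \<open>Matrices over commutative rings with x^5 = x\<close>

lemma (in abelian_monoid) additive_sum:
  assumes "\<And>x. \<kappa> x \<in> carrier G" "\<kappa> 0 = \<zero>" "\<And>x y. \<kappa> (x + y) = \<kappa> x \<oplus> \<kappa> y" "finite A"
  shows "\<kappa> (sum f A) = (\<Oplus>i\<in>A. \<kappa> (f i))"
  using assms(4)
  by (induction A rule: finite_induct) (simp_all add: assms(1-3) Pi_iff finsum_insert)

text \<open>
  Below an idempotent \<open>d\<close> killed by the prime \<open>p\<close>, the integer multiples of \<open>d\<close> are an image of the
  field with \<open>p\<close> elements, so matrices over that field map to matrices over the ring.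
\<close>

lemma (in cring) rng_hom_prime_field:
  fixes d
  assumes d: "ring_idempotent R d" and p: "add_pow R (int CARD('p :: prime_card)) d = \<zero>"
  defines "\<kappa> \<equiv> \<lambda>x :: 'p mod_ring. add_pow R (to_int_mod_ring x) d"
  shows "rng_hom (full_mat_ring TYPE('p mod_ring) n) (mat_ring R n) (map_mat \<kappa>)"
    and "\<kappa> (of_int k) = add_pow R k d"
proof -
  have dc: "d \<in> carrier R" "d \<otimes> d = d" using d by (simp_all add: ring_idempotent_def)
  have reduce: "add_pow R (k mod int CARD('p)) d = add_pow R k d" for k
  proof -
    have "add_pow R k d = add_pow R (k mod int CARD('p) + int CARD('p) * (k div int CARD('p))) d"
      by simp
    also have "\<dots> = add_pow R (k mod int CARD('p)) d \<oplus> add_pow R (k div int CARD('p)) (add_pow R (int CARD('p)) d)"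
      using dc by (simp only: add.int_pow_mult add.int_pow_pow)
    finally show ?thesis using dc by (simp add: p)
  qed
  have cl: "\<kappa> x \<in> carrier R" for x using dc by (simp add: \<kappa>_def)
  have ad: "\<kappa> (x + y) = \<kappa> x \<oplus> \<kappa> y" for x y
    using dc by (simp add: \<kappa>_def to_int_mod_ring_add reduce add.int_pow_mult)
  have ml: "\<kappa> (x * y) = \<kappa> x \<otimes> \<kappa> y" for x y
    using dc by (simp add: \<kappa>_def to_int_mod_ring_mult reduce add_pow_ldistr_int add_pow_rdistr_int
        add.int_pow_pow mult.commute)
  have ze: "\<kappa> 0 = \<zero>" using ad[of 0 0] cl[of 0] by simp
  show "\<kappa> (of_int k) = add_pow R k d"
  proof -
    have "to_int_mod_ring (of_int k :: 'p mod_ring) = k mod int CARD('p)"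
      unfolding of_int_of_int_mod_ring by transfer simp
    then show ?thesis by (simp add: \<kappa>_def reduce)
  qed
  let ?M = "mat_ring R n"
  show "rng_hom (full_mat_ring TYPE('p mod_ring) n) ?M (map_mat \<kappa>)"
  proof (intro rng_hom.intro rng_hom_axioms.intro ring_mat mat_ring_ring; unfold ring_mat_simps)
    fix X Y :: "'p mod_ring mat" assume X: "X \<in> carrier_mat n n"
    then show "map_mat \<kappa> X \<in> carrier ?M" by (auto simp: mat_ring_carrier_iff cl)
    assume Y: "Y \<in> carrier_mat n n"
    show "map_mat \<kappa> (X + Y) = map_mat \<kappa> X \<oplus>\<^bsub>?M\<^esub> map_mat \<kappa> Y"
      by (rule mat_ring_eqI[OF _ mat_ring_dim(2)]) (use X Y in \<open>simp_all add: mat_ring_index ad\<close>)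
    show "map_mat \<kappa> (X * Y) = map_mat \<kappa> X \<otimes>\<^bsub>?M\<^esub> map_mat \<kappa> Y"
    proof (rule mat_ring_eqI[OF _ mat_ring_dim(1)])
      fix i j assume ij: "i < n" "j < n"
      have "map_mat \<kappa> (X * Y) $$ (i, j) = \<kappa> (\<Sum>l<n. X $$ (i, l) * Y $$ (l, j))"
        using X Y ij by (simp add: scalar_prod_def lessThan_atLeast0)
      also have "\<dots> = (\<Oplus>l\<in>{..<n}. \<kappa> (X $$ (i, l) * Y $$ (l, j)))"
        by (rule additive_sum[OF cl ze ad]) simp
      also have "\<dots> = (\<Oplus>l\<in>{..<n}. map_mat \<kappa> X $$ (i, l) \<otimes> map_mat \<kappa> Y $$ (l, j))"
        using X Y ij by (intro finsum_cong') (auto simp: ml cl)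
      finally show "map_mat \<kappa> (X * Y) $$ (i, j) = (map_mat \<kappa> X \<otimes>\<^bsub>?M\<^esub> map_mat \<kappa> Y) $$ (i, j)"
        using ij by (simp add: mat_ring_index)
    qed (use X Y in simp)
  qed
qed

text \<open>
  For 2, 3 and 5 elements every residue is represented by one of \<open>-2, ..., 2\<close>; this fails for larger
  primes.
\<close>

lemma mod_ring_sum_of_signs:
  fixes x :: "'p :: prime_card mod_ring"
  assumes "CARD('p) \<in> {2, 3, 5}"
  shows "\<exists>s t. x = s + t \<and> (s = 1 \<or> s = -1) \<and> (t = 0 \<or> t = 1 \<or> t = -1)"
proof -
  obtain i where i: "i < CARD('p)" "x = of_nat i" using surj_of_nat_mod_ring by blast
  then consider "x = 0" | "x = 1" | "x = 2" | "CARD('p) = 5" "x = 3" | "CARD('p) = 5" "x = 4"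
    using assms by (auto simp: less_Suc_eq numeral_eq_Suc)
  then show ?thesis
  proof cases
    case 1 then show ?thesis by (intro exI[of _ 1] exI[of _ "-1"]) simp
  next
    case 2 then show ?thesis by (intro exI[of _ 1] exI[of _ "0"]) simp
  next
    case 3 then show ?thesis by (intro exI[of _ 1] exI[of _ "1"]) simp
  next
    case 4
    then have "(5 :: 'p mod_ring) = 0" using of_nat_card_eq_0[where 'a = 'p] by simp
    then have "x = -1 + -1" using 4 by (simp add: eq_neg_iff_add_eq_0)
    then show ?thesis by blast
  next
    case 5
    then have "(5 :: 'p mod_ring) = 0" using of_nat_card_eq_0[where 'a = 'p] by simp
    then have "x = -1 + 0" using 5 by (simp add: eq_neg_iff_add_eq_0)
    then show ?thesis by blast
  qed
qed

definition scale :: "('a, 'b) ring_scheme \<Rightarrow> 'a \<Rightarrow> 'a mat \<Rightarrow> 'a mat" where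
  "scale R c X = map_mat (\<lambda>x. c \<otimes>\<^bsub>R\<^esub> x) X"

lemma (in cring) local_tripotent_nil_sum:
  assumes card: "CARD('p :: prime_card) \<in> {2, 3, 5}"
    and d: "ring_idempotent R d" and p: "add_pow R (int CARD('p)) d = \<zero>"
    and A: "A \<in> carrier (mat_ring R n)"
    and scalar: "\<And>i j. i < n \<Longrightarrow> j < n \<Longrightarrow> \<exists>k::int. d \<otimes> A $$ (i, j) = add_pow R k d"
  shows "tripotent_nil_sum (mat_ring R n) (scale R d A)"
proof -
  obtain k :: "nat \<Rightarrow> nat \<Rightarrow> int" where k: "\<And>i j. i < n \<Longrightarrow> j < n \<Longrightarrow> d \<otimes> A $$ (i, j) = add_pow R (k i j) d"
    using scalar by metis
  define B where "B = mat n n (\<lambda>(i, j). of_int (k i j) :: 'p mod_ring)"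
  interpret rng_hom "full_mat_ring TYPE('p mod_ring) n" "mat_ring R n"
    "map_mat (\<lambda>x :: 'p mod_ring. add_pow R (to_int_mod_ring x) d)"
    by (rule rng_hom_prime_field[OF d p])
  have "tripotent_nil_sum (full_mat_ring TYPE('p mod_ring) n) B"
    by (rule matrix_tripotent_nil_sum[OF mod_ring_sum_of_signs[OF card]]) (simp add: B_def)
  from tripotent_nil_sum[OF this] show ?thesis
  proof (rule back_subst[where P = "tripotent_nil_sum _"])
    show "map_mat (\<lambda>x :: 'p mod_ring. add_pow R (to_int_mod_ring x) d) B = scale R d A"
      using A by (intro eq_matI)
        (auto simp: B_def scale_def mat_ring_carrier_iff k rng_hom_prime_field(2)[OF d p])
  qed
qed

text \<open>
  Gluing matrices along orthogonal idempotents preserves sums and products.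
\<close>

lemma (in cring) rng_hom_scale_pair:
  assumes c: "ring_idempotent R c" and d: "ring_idempotent R d" and cd: "c \<otimes> d = \<zero>"
  shows "rng_hom (RDirProd (mat_ring R n) (mat_ring R n)) (mat_ring R n)
    (\<lambda>(X, Y). scale R c X \<oplus>\<^bsub>mat_ring R n\<^esub> scale R d Y)"
proof -
  let ?M = "mat_ring R n"
  have cc: "c \<in> carrier R" "d \<in> carrier R" "c \<otimes> c = c" "d \<otimes> d = d"
    using c d by (simp_all add: ring_idempotent_def)
  have ent: "(scale R c X \<oplus>\<^bsub>?M\<^esub> scale R d Y) $$ (i, j) = c \<otimes> X $$ (i, j) \<oplus> d \<otimes> Y $$ (i, j)"
    if "X \<in> carrier_mat n n" "Y \<in> carrier_mat n n" "i < n" "j < n" for X Y i j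
    using that by (simp add: mat_ring_index scale_def)
  have mul: "(c \<otimes> x \<oplus> d \<otimes> y) \<otimes> (c \<otimes> x' \<oplus> d \<otimes> y') = c \<otimes> (x \<otimes> x') \<oplus> d \<otimes> (y \<otimes> y')"
    if v: "x \<in> carrier R" "y \<in> carrier R" "x' \<in> carrier R" "y' \<in> carrier R" for x y x' y'
  proof -
    have "(c \<otimes> x \<oplus> d \<otimes> y) \<otimes> (c \<otimes> x' \<oplus> d \<otimes> y')
        = (c \<otimes> c) \<otimes> (x \<otimes> x') \<oplus> (c \<otimes> d) \<otimes> (x \<otimes> y') \<oplus> ((c \<otimes> d) \<otimes> (y \<otimes> x') \<oplus> (d \<otimes> d) \<otimes> (y \<otimes> y'))"
      using v cc(1,2) by (simp add: l_distr r_distr m_ac a_ac)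
    then show ?thesis using v cc cd by simp
  qed
  show ?thesis
  proof (intro rng_hom.intro rng_hom_axioms.intro RDirProd_ring mat_ring_ring)
    fix p q assume "p \<in> carrier (RDirProd ?M ?M)" "q \<in> carrier (RDirProd ?M ?M)"
    then obtain X Y X' Y' where pq: "p = (X, Y)" "q = (X', Y')"
      and M: "X \<in> carrier ?M" "Y \<in> carrier ?M" "X' \<in> carrier ?M" "Y' \<in> carrier ?M"
      by (auto simp: RDirProd_simps)
    then have dim: "X \<in> carrier_mat n n" "Y \<in> carrier_mat n n" "X' \<in> carrier_mat n n" "Y' \<in> carrier_mat n n"
      and ec: "\<And>i j. i < n \<Longrightarrow> j < n \<Longrightarrow> X $$ (i, j) \<in> carrier R \<and> Y $$ (i, j) \<in> carrier R
        \<and> X' $$ (i, j) \<in> carrier R \<and> Y' $$ (i, j) \<in> carrier R"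
      by (simp_all add: mat_ring_carrier_iff)
    let ?f = "\<lambda>(X, Y). scale R c X \<oplus>\<^bsub>?M\<^esub> scale R d Y"
    show "?f (p \<oplus>\<^bsub>RDirProd ?M ?M\<^esub> q) = ?f p \<oplus>\<^bsub>?M\<^esub> ?f q"
      unfolding pq RDirProd_simps prod.case
    proof (rule mat_ring_eqI[OF mat_ring_dim(2) mat_ring_dim(2)])
      fix i j assume ij: "i < n" "j < n"
      then show "(scale R c (X \<oplus>\<^bsub>?M\<^esub> X') \<oplus>\<^bsub>?M\<^esub> scale R d (Y \<oplus>\<^bsub>?M\<^esub> Y')) $$ (i, j)
          = (scale R c X \<oplus>\<^bsub>?M\<^esub> scale R d Y \<oplus>\<^bsub>?M\<^esub> (scale R c X' \<oplus>\<^bsub>?M\<^esub> scale R d Y')) $$ (i, j)"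
        using ec[OF ij] dim cc
        by (simp add: ent mat_ring_dim mat_ring_index_add[where A = "scale R c X \<oplus>\<^bsub>?M\<^esub> scale R d Y"]
            mat_ring_index_add[where A = X] mat_ring_index_add[where A = Y] r_distr a_ac)
    qed
    show "?f (p \<otimes>\<^bsub>RDirProd ?M ?M\<^esub> q) = ?f p \<otimes>\<^bsub>?M\<^esub> ?f q"
      unfolding pq RDirProd_simps prod.case
    proof (rule mat_ring_eqI[OF mat_ring_dim(2) mat_ring_dim(1)])
      fix i j assume ij: "i < n" "j < n"
      have "(scale R c (X \<otimes>\<^bsub>?M\<^esub> X') \<oplus>\<^bsub>?M\<^esub> scale R d (Y \<otimes>\<^bsub>?M\<^esub> Y')) $$ (i, j)
          = c \<otimes> (\<Oplus>k\<in>{..<n}. X $$ (i, k) \<otimes> X' $$ (k, j)) \<oplus> d \<otimes> (\<Oplus>k\<in>{..<n}. Y $$ (i, k) \<otimes> Y' $$ (k, j))"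
        using ij by (simp add: ent mat_ring_dim mat_ring_index_mult)
      also have "\<dots> = (\<Oplus>k\<in>{..<n}. c \<otimes> (X $$ (i, k) \<otimes> X' $$ (k, j))) \<oplus> (\<Oplus>k\<in>{..<n}. d \<otimes> (Y $$ (i, k) \<otimes> Y' $$ (k, j)))"
        using ij ec cc by (simp add: finsum_rdistr Pi_iff)
      also have "\<dots> = (\<Oplus>k\<in>{..<n}. c \<otimes> (X $$ (i, k) \<otimes> X' $$ (k, j)) \<oplus> d \<otimes> (Y $$ (i, k) \<otimes> Y' $$ (k, j)))"
        using ij ec cc by (intro finsum_addf[symmetric]) auto
      also have "\<dots> = (\<Oplus>k\<in>{..<n}. (scale R c X \<oplus>\<^bsub>?M\<^esub> scale R d Y) $$ (i, k) \<otimes> (scale R c X' \<oplus>\<^bsub>?M\<^esub> scale R d Y') $$ (k, j))"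
        using ij ec cc dim by (intro finsum_cong') (auto simp: ent mul)
      finally show "(scale R c (X \<otimes>\<^bsub>?M\<^esub> X') \<oplus>\<^bsub>?M\<^esub> scale R d (Y \<otimes>\<^bsub>?M\<^esub> Y')) $$ (i, j)
          = ((scale R c X \<oplus>\<^bsub>?M\<^esub> scale R d Y) \<otimes>\<^bsub>?M\<^esub> (scale R c X' \<oplus>\<^bsub>?M\<^esub> scale R d Y')) $$ (i, j)"
        unfolding mat_ring_index_mult[OF ij] .
    qed
    show "?f p \<in> carrier ?M"
      using ec dim cc by (auto simp: pq mat_ring_carrier_iff mat_ring_dim ent)
  qed
qed

text \<open>
  Index types for the fields with 3 and 5 elements: \<open>'p mod_ring\<close> is the ring of integers modulo the
  cardinality of \<open>'p\<close>. The type \<^typ>\<open>bool\<close> serves for 2.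
\<close>

typedef residue3 = "{0..<3 :: nat}" by (rule exI[of _ 0]) simp
typedef residue5 = "{0..<5 :: nat}" by (rule exI[of _ 0]) simp

lemma CARD_residue: "CARD(residue3) = 3" "CARD(residue5) = 5"
  using type_definition.card[OF type_definition_residue3] type_definition.card[OF type_definition_residue5]
  by simp_all

instance residue3 :: prime_card by standard (simp add: CARD_residue)
instance residue5 :: prime_card by standard (simp add: CARD_residue)

text \<open>
  The property \<open>Q c\<close> says that the part \<open>c A\<close> of \<open>A\<close> agrees with the part \<open>c B\<close> of a decomposable
  matrix \<open>B\<close>. It is additive by gluing, and it holds below idempotents on which all entries of \<open>A\<close>
  are integers modulo 2, 3 or 5, by the result for fields. For \<open>c = 1\<close> it is the claim.
\<close>

theorem (in quintic_ring) mat_ring_tripotent_nil_sum: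
  assumes A: "A \<in> carrier (mat_ring R n)"
  shows "tripotent_nil_sum (mat_ring R n) A"
proof -
  let ?M = "mat_ring R n"
  define Q where "Q c \<longleftrightarrow> (\<exists>B\<in>carrier ?M. tripotent_nil_sum ?M B \<and> scale R c A = scale R c B)" for c
  have Ac: "A \<in> carrier_mat n n" "\<And>i j. i < n \<Longrightarrow> j < n \<Longrightarrow> A $$ (i, j) \<in> carrier R"
    using A by (simp_all add: mat_ring_carrier_iff)
  have add: "Q (c \<oplus> d)"
    if c: "ring_idempotent R c" and d: "ring_idempotent R d" and cd: "c \<otimes> d = \<zero>" and "Q c" "Q d" for c d
  proof -
    obtain B C where B: "B \<in> carrier ?M" "tripotent_nil_sum ?M B" "scale R c A = scale R c B"
      and C: "C \<in> carrier ?M" "tripotent_nil_sum ?M C" "scale R d A = scale R d C"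
      using \<open>Q c\<close> \<open>Q d\<close> unfolding Q_def by blast
    let ?f = "\<lambda>(X, Y). scale R c X \<oplus>\<^bsub>?M\<^esub> scale R d Y"
    interpret f: rng_hom "RDirProd ?M ?M" ?M ?f by (rule rng_hom_scale_pair[OF c d cd])
    have cc: "c \<in> carrier R" "d \<in> carrier R" "c \<otimes> c = c" "d \<otimes> d = d"
      using c d by (simp_all add: ring_idempotent_def)
    have "tripotent_nil_sum ?M (?f (B, C))"
      by (rule f.tripotent_nil_sum) (intro RDirProd_tripotent_nil_sum mat_ring_ring B C)
    moreover have "?f (B, C) \<in> carrier ?M" by (rule f.closed) (simp add: RDirProd_simps B C)
    moreover have "scale R (c \<oplus> d) A = scale R (c \<oplus> d) (?f (B, C))"
    proof -
      have "?f (B, C) = ?f (A, A)" by (simp add: B C)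
      moreover have "scale R (c \<oplus> d) A = scale R (c \<oplus> d) (?f (A, A))"
      proof (rule mat_ring_eqI[where n = n])
        fix i j assume ij: "i < n" "j < n"
        have "(c \<oplus> d) \<otimes> (c \<otimes> a \<oplus> d \<otimes> a) = (c \<oplus> d) \<otimes> a" if a: "a \<in> carrier R" for a
        proof -
          have "(c \<oplus> d) \<otimes> (c \<otimes> a \<oplus> d \<otimes> a)
              = (c \<otimes> c) \<otimes> a \<oplus> (c \<otimes> d) \<otimes> a \<oplus> ((c \<otimes> d) \<otimes> a \<oplus> (d \<otimes> d) \<otimes> a)"
            using a cc(1,2) by (simp add: l_distr r_distr m_ac a_ac)
          then show ?thesis using a cc cd by (simp add: l_distr)
        qed
        then show "scale R (c \<oplus> d) A $$ (i, j) = scale R (c \<oplus> d) (?f (A, A)) $$ (i, j)"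
          using ij Ac mat_ring_dim(2)[of R n "scale R c A" "scale R d A"]
          by (simp add: scale_def mat_ring_index)
      qed (use Ac mat_ring_dim(2)[of R n "scale R c A" "scale R d A"] in \<open>auto simp: scale_def\<close>)
      ultimately show ?thesis by simp
    qed
    ultimately show ?thesis unfolding Q_def by blast
  qed
  have "Q \<one>"
  proof (rule separate_characteristic[where Q = Q, OF add])
    fix c and p :: int assume c: "ring_idempotent R c" and p: "p \<in> {2, 3, 5}" "add_pow R p c = \<zero>"
    let ?X = "(\<lambda>(i, j). A $$ (i, j)) ` ({..<n} \<times> {..<n})"
    show "Q c"
    proof (rule separate_finite[where Q = Q and X = ?X, OF add])
      show "?X \<subseteq> carrier R" using Ac by auto
      fix d assume d: "ring_idempotent R d" "c \<otimes> d = d" and "\<forall>x\<in>?X. \<exists>k::int. d \<otimes> x = add_pow R k d"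
      then have scalar: "\<exists>k::int. d \<otimes> A $$ (i, j) = add_pow R k d" if "i < n" "j < n" for i j
        using that by auto
      have dc: "d \<in> carrier R" "d \<otimes> d = d" "c \<in> carrier R" using d c by (simp_all add: ring_idempotent_def)
      have pd: "add_pow R p d = \<zero>"
        using p(2) add_pow_ldistr_int[of c d p] d(2) dc by simp
      have "tripotent_nil_sum ?M (scale R d A)"
      proof -
        consider "p = 2" | "p = 3" | "p = 5" using p by auto
        then show ?thesis
        proof cases
          case 1
          then show ?thesis
            using local_tripotent_nil_sum[where 'p = bool, OF _ d(1) _ A scalar] pd by simp
        next
          case 2
          then show ?thesis
            using local_tripotent_nil_sum[where 'p = residue3, OF _ d(1) _ A scalar] pd
            by (simp add: CARD_residue)
        next
          case 3
          then show ?thesis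
            using local_tripotent_nil_sum[where 'p = residue5, OF _ d(1) _ A scalar] pd
            by (simp add: CARD_residue)
        qed
      qed
      moreover have "scale R d A \<in> carrier ?M"
        using Ac dc by (auto simp: scale_def mat_ring_carrier_iff)
      moreover have "scale R d A = scale R d (scale R d A)"
        by (rule mat_ring_eqI[where n = n]) (use Ac dc in \<open>auto simp: scale_def simp flip: m_assoc\<close>)
      ultimately show "Q d" unfolding Q_def by blast
    qed (use c in auto)
  qed
  then obtain B where B: "B \<in> carrier ?M" "tripotent_nil_sum ?M B" "scale R \<one> A = scale R \<one> B"
    unfolding Q_def by blast
  have "scale R \<one> X = X" if "X \<in> carrier ?M" for X
    by (rule mat_ring_eqI[where n = n]) (use that in \<open>auto simp: scale_def mat_ring_carrier_iff\<close>)
  then show ?thesis using A B by simp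
qed

section \<open>Matrices over a 2-primal Zhou nil-clean ring\<close>

lemma (in ideal) quotient_carrier_cases:
  assumes "X \<in> carrier (R Quot I)"
  obtains a where "a \<in> carrier R" "X = I +> a"
proof -
  have "X \<in> (\<Union>a\<in>carrier R. {I +> a})"
    using assms unfolding FactRing_def A_RCOSETS_def' partial_object.simps .
  then show ?thesis using that by blast
qed

lemma (in ideal) quotient_zero_iff:
  assumes "a \<in> carrier R"
  shows "I +> a = \<zero>\<^bsub>R Quot I\<^esub> \<longleftrightarrow> a \<in> I"
proof -
  have "I +> a = I \<longleftrightarrow> a \<in> I"
    using a_rcos_self[OF assms] a_rcos_const by metis
  then show ?thesis by (simp only: FactRing_def ring.simps)
qed

text \<open>
  The nilpotent summand disappears modulo the radical, and the quotient is reduced because the radical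
  consists of all nilpotent elements.
\<close>

lemma (in ring) zhou_quotient_quintic:
  assumes "two_primal R" "zhou_nil_clean R"
  shows "quintic_ring (R Quot baer_mccoy_radical R)"
proof -
  let ?P = "baer_mccoy_radical R"
  let ?S = "R Quot ?P"
  have P: "?P = {a. nilpotent R a}" using assms(1) by (simp add: two_primal_def)
  interpret P: ideal ?P R by (rule baer_mccoy_radical_ideal)
  interpret \<pi>: ring_hom_ring R ?S "(+>) ?P" by (rule P.rcos_ring_hom_ring)
  let ?\<pi> = "(+>) ?P"
  have surj: "\<exists>a\<in>carrier R. X = ?\<pi> a" if "X \<in> carrier ?S" for X
    using P.quotient_carrier_cases[OF that] by blast
  have ker: "?\<pi> a = \<zero>\<^bsub>?S\<^esub> \<longleftrightarrow> nilpotent R a" if "a \<in> carrier R" for a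
    using P.quotient_zero_iff[OF that] P by simp
  have quint: "X [^]\<^bsub>?S\<^esub> (5::nat) = X" if "X \<in> carrier ?S" for X
  proof (rule \<pi>.S.sum_of_commuting_tripotents_quintic[OF _ _ that])
    fix X assume X: "X \<in> carrier ?S" "X \<otimes>\<^bsub>?S\<^esub> X = \<zero>\<^bsub>?S\<^esub>"
    then obtain a where a: "a \<in> carrier R" "X = ?\<pi> a" using surj by blast
    then have "?\<pi> (a \<otimes> a) = \<zero>\<^bsub>?S\<^esub>" using X by simp
    then obtain k :: nat where "(a \<otimes> a) [^] k = \<zero>"
      using ker[of "a \<otimes> a"] a unfolding nilpotent_def by blast
    then have "a [^] (2 * k) = \<zero>"
      using a nat_pow_pow[of a 2 k] by (simp add: numeral_2_eq_2)
    then show "X = \<zero>\<^bsub>?S\<^esub>" using ker a by (auto simp: nilpotent_def)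
  next
    fix X assume "X \<in> carrier ?S"
    then obtain a where a: "a \<in> carrier R" "X = ?\<pi> a" using surj by blast
    obtain e f w where d: "tripotent R e" "tripotent R f" "nilpotent R w" "commuting R e f" "a = e \<oplus> f \<oplus> w"
      using assms(2) a unfolding zhou_nil_clean_def by blast
    then have c: "e \<in> carrier R" "f \<in> carrier R" "w \<in> carrier R" "e [^] (3::nat) = e" "f [^] (3::nat) = f"
      by (simp_all add: tripotent_def nilpotent_def)
    have "X = ?\<pi> e \<oplus>\<^bsub>?S\<^esub> ?\<pi> f"
      using a d(5) c ker[of w] d(3) by simp
    moreover have "tripotent ?S (?\<pi> e)" "tripotent ?S (?\<pi> f)"
      using c by (simp_all add: tripotent_def flip: \<pi>.hom_nat_pow)
    moreover have "commuting ?S (?\<pi> f) (?\<pi> e)"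
      using c d(4) by (simp add: commuting_def flip: \<pi>.hom_mult)
    ultimately show "\<exists>e f. tripotent ?S e \<and> tripotent ?S f \<and> commuting ?S f e \<and> X = e \<oplus>\<^bsub>?S\<^esub> f"
      by blast
  qed
  interpret cring ?S by (rule \<pi>.S.quintic_commutative[OF quint])
  show ?thesis by unfold_locales (rule quint)
qed

theorem theorem3p2:
  fixes R :: "('a, 'b) ring_scheme"
  assumes "ring R"
    and "two_primal R"
    and "zhou_nil_clean R"
  shows "\<forall>n\<ge>1. \<forall>A\<in>carrier (mat_ring R n). \<exists>E F W.
           tripotent (mat_ring R n) E \<and>
           tripotent (mat_ring R n) F \<and>
           nilpotent (mat_ring R n) W \<and>
           A = E \<oplus>\<^bsub>mat_ring R n\<^esub> F \<oplus>\<^bsub>mat_ring R n\<^esub> W"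
proof (intro allI impI ballI)
  fix n :: nat and A assume A: "A \<in> carrier (mat_ring R n)"
  interpret R: ring R by fact
  let ?P = "baer_mccoy_radical R"
  let ?S = "R Quot ?P" and ?\<pi> = "(+>\<^bsub>R\<^esub>) ?P"
  interpret P: ideal ?P R by (rule R.baer_mccoy_radical_ideal)
  interpret \<pi>: ring_hom_ring R ?S ?\<pi> by (rule P.rcos_ring_hom_ring)
  interpret S: quintic_ring ?S by (rule R.zhou_quotient_quintic[OF assms(2,3)])
  interpret M: ring_hom_ring "mat_ring R n" "mat_ring ?S n" "map_mat ?\<pi>" by (rule \<pi>.mat_ring_hom)
  have "tripotent_nil_sum (mat_ring R n) A"
  proof (rule M.lift_tripotent_nil_sum[OF _ _ A])
    fix X assume X: "X \<in> carrier (mat_ring R n)" "map_mat ?\<pi> X = \<zero>\<^bsub>mat_ring ?S n\<^esub>"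
    have "X $$ (i, j) \<in> ?P" if ij: "i < n" "j < n" for i j
    proof -
      have Xij: "X $$ (i, j) \<in> carrier R" using X ij by (simp add: mat_ring_carrier_iff)
      have "?\<pi> (X $$ (i, j)) = \<zero>\<^bsub>?S\<^esub>"
      proof -
        have "?\<pi> (X $$ (i, j)) = map_mat ?\<pi> X $$ (i, j)"
          using X(1) ij by (auto simp: mat_ring_carrier_iff)
        then show ?thesis unfolding X(2) using ij by (simp add: mat_ring_index)
      qed
      then show ?thesis using P.quotient_zero_iff[OF Xij] by simp
    qed
    then show "nilpotent (mat_ring R n) X"
      using X by (intro R.mat_over_prime_radical_nilpotent) (simp add: mat_over_def mat_ring_carrier_iff)
  next
    show "map_mat ?\<pi> ` carrier (mat_ring R n) = carrier (mat_ring ?S n)"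
    proof (intro equalityI subsetI)
      fix Y assume Y: "Y \<in> carrier (mat_ring ?S n)"
      have "\<exists>a\<in>carrier R. Y $$ (i, j) = ?\<pi> a" if "i < n" "j < n" for i j
      proof -
        have "Y $$ (i, j) \<in> carrier ?S" using Y that by (simp add: mat_ring_carrier_iff)
        then show ?thesis by (rule P.quotient_carrier_cases) blast
      qed
      then obtain x where x: "\<And>i j. i < n \<Longrightarrow> j < n \<Longrightarrow> x i j \<in> carrier R \<and> Y $$ (i, j) = ?\<pi> (x i j)"
        by metis
      have "Y = map_mat ?\<pi> (mat n n (\<lambda>(i, j). x i j))"
        using Y x by (intro eq_matI) (auto simp: mat_ring_carrier_iff)
      moreover have "mat n n (\<lambda>(i, j). x i j) \<in> carrier (mat_ring R n)"
        using x by (auto simp: mat_ring_carrier_iff)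
      ultimately show "Y \<in> map_mat ?\<pi> ` carrier (mat_ring R n)" by blast
    qed (use M.hom_closed in blast)
    show "tripotent_nil_sum (mat_ring ?S n) (map_mat ?\<pi> A)"
      by (rule S.mat_ring_tripotent_nil_sum) (rule M.hom_closed[OF A])
  qed
  then show "\<exists>E F W. tripotent (mat_ring R n) E \<and> tripotent (mat_ring R n) F \<and>
      nilpotent (mat_ring R n) W \<and> A = E \<oplus>\<^bsub>mat_ring R n\<^esub> F \<oplus>\<^bsub>mat_ring R n\<^esub> W"
    unfolding tripotent_nil_sum_def using M.R.split_tripotent_imp_tripotent by blast
qed

end
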